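(* Let $(\mathscr{A},\mathscr{E})$ be an exact category. Consider a commutative square in $\mathscr{A}$ given by $i:A\to B$, $f:A\to A'$, $f':B\to B'$, $i':A'\to B'$ with $f'i=i'f$, in which $i$ and $i'$ are admissible monics. The following assertions are equivalent: (i) The square is a push-out. (ii) The sequence $A\xrightarrow{\left[\begin{smallmatrix} i\\ -f\end{smallmatrix}\right]}B\oplus A'\xrightarrow{\left[\begin{smallmatrix} f' & i'\end{smallmatrix}\right]}B'$ is short exact. (iii) The square is bicartesian, i.e. both a push-out and a pull-back. (iv) The square is part of a commutative diagram with short exact rows $$\begin{array}{ccccc} A & \xrightarrow{i} & B & \xrightarrow{p} & C\\ {\scriptstyle f}\downarrow & & {\scriptstyle f'}\downarrow & & {\scriptstyle 1_C}\downarrow\\ A' & \xrightarrow{i'} & B' & \xrightarrow{p'} & C,\end{array}$$ i.e. there are an object $C$ and morphisms $p:B\to C$, $p':B'\to C$ with $p'f'=p$ and $(i,p),(i',p')\in\mathscr{E}$.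
   Context: A kernel-cokernel pair in an additive category $\mathscr{A}$ is a pair of composable morphisms $A'\xrightarrow{i}A\xrightarrow{p}A''$ such that $i$ is a kernel of $p$ and $p$ is a cokernel of $i$. Given a class $\mathscr{E}$ of kernel-cokernel pairs, an admissible monic is a morphism $i$ for which there is $p$ with $(i,p)\in\mathscr{E}$; an admissible epic is a morphism $p$ for which there is $i$ with $(i,p)\in\mathscr{E}$. An exact structure on $\mathscr{A}$ is a class $\mathscr{E}$ of kernel-cokernel pairs closed under isomorphisms such that: all identity morphisms are admissible monics and admissible epics; admissible monics are closed under composition and admissible epics are closed under composition; the push-out of an admissible monic along an arbitrary morphism exists and yields an admissible monic; the pull-back of an admissible epic along an arbitrary morphism exists and yields an admissible epic. An exact category is a pair $(\mathscr{A},\mathscr{E})$ of an additive category and an exact structure on it; elements of $\mathscr{E}$ are called short exact sequences. *)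

theory Defs
  imports "HOL-Algebra.Group"
begin

section \<open>Categories\<close>

text \<open>Composition is only meaningful on composable arrows of \<open>Arr\<close>, and addition only on parallel
  ones; the values elsewhere are unconstrained.\<close>

record ('o, 'm) cat =
  Obj :: "'o set"
  Arr :: "'m set"
  Dom :: "'m \<Rightarrow> 'o"
  Cod :: "'m \<Rightarrow> 'o"
  Ident :: "'o \<Rightarrow> 'm"
  Comp :: "'m \<Rightarrow> 'm \<Rightarrow> 'm"  (infixr \<open>\<cdot>\<index>\<close> 75)

definition Hom :: "('o, 'm, 'z) cat_scheme \<Rightarrow> 'o \<Rightarrow> 'o \<Rightarrow> 'm set" where
  "Hom C A B = {f \<in> Arr C. Dom C f = A \<and> Cod C f = B}"

locale category =
  fixes C :: "('o, 'm, 'z) cat_scheme" (structure)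
  assumes Dom_in_Obj: "f \<in> Arr C \<Longrightarrow> Dom C f \<in> Obj C"
    and Cod_in_Obj: "f \<in> Arr C \<Longrightarrow> Cod C f \<in> Obj C"
    and Ident_in_Hom: "A \<in> Obj C \<Longrightarrow> Ident C A \<in> Hom C A A"
    and Comp_in_Hom: "\<lbrakk>f \<in> Hom C A B; g \<in> Hom C B D\<rbrakk> \<Longrightarrow> g \<cdot> f \<in> Hom C A D"
    and Comp_Ident_left: "f \<in> Hom C A B \<Longrightarrow> Ident C B \<cdot> f = f"
    and Comp_Ident_right: "f \<in> Hom C A B \<Longrightarrow> f \<cdot> Ident C A = f"
    and Comp_assoc:
      "\<lbrakk>f \<in> Hom C A B; g \<in> Hom C B D; h \<in> Hom C D F\<rbrakk> \<Longrightarrow> (h \<cdot> g) \<cdot> f = h \<cdot> (g \<cdot> f)"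

definition is_iso :: "('o, 'm, 'z) cat_scheme \<Rightarrow> 'm \<Rightarrow> bool" where
  "is_iso C f \<longleftrightarrow> f \<in> Arr C \<and>
     (\<exists>g \<in> Hom C (Cod C f) (Dom C f).
        g \<cdot>\<^bsub>C\<^esub> f = Ident C (Dom C f) \<and> f \<cdot>\<^bsub>C\<^esub> g = Ident C (Cod C f))"

text \<open>In the next four definitions the arguments \<open>i, f, f', i'\<close> are the sides of the square
  \<open>i : A \<rightarrow> B\<close>, \<open>f : A \<rightarrow> A'\<close>, \<open>f' : B \<rightarrow> B'\<close>, \<open>i' : A' \<rightarrow> B'\<close>.\<close>

definition commutative_square ::
    "('o, 'm, 'z) cat_scheme \<Rightarrow> 'm \<Rightarrow> 'm \<Rightarrow> 'm \<Rightarrow> 'm \<Rightarrow> bool" where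
  "commutative_square C i f f' i' \<longleftrightarrow>
     {i, f, f', i'} \<subseteq> Arr C \<and> Dom C i = Dom C f \<and> Cod C i = Dom C f' \<and>
     Cod C f = Dom C i' \<and> Cod C f' = Cod C i' \<and> f' \<cdot>\<^bsub>C\<^esub> i = i' \<cdot>\<^bsub>C\<^esub> f"

definition is_pushout :: "('o, 'm, 'z) cat_scheme \<Rightarrow> 'm \<Rightarrow> 'm \<Rightarrow> 'm \<Rightarrow> 'm \<Rightarrow> bool" where
  "is_pushout C i f f' i' \<longleftrightarrow> commutative_square C i f f' i' \<and>
     (\<forall>X \<in> Obj C. \<forall>g \<in> Hom C (Cod C i) X. \<forall>h \<in> Hom C (Cod C f) X.
        g \<cdot>\<^bsub>C\<^esub> i = h \<cdot>\<^bsub>C\<^esub> f \<longrightarrow>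
        (\<exists>!u. u \<in> Hom C (Cod C f') X \<and> u \<cdot>\<^bsub>C\<^esub> f' = g \<and> u \<cdot>\<^bsub>C\<^esub> i' = h))"

definition is_pullback :: "('o, 'm, 'z) cat_scheme \<Rightarrow> 'm \<Rightarrow> 'm \<Rightarrow> 'm \<Rightarrow> 'm \<Rightarrow> bool" where
  "is_pullback C i f f' i' \<longleftrightarrow> commutative_square C i f f' i' \<and>
     (\<forall>X \<in> Obj C. \<forall>g \<in> Hom C X (Dom C f'). \<forall>h \<in> Hom C X (Dom C i').
        f' \<cdot>\<^bsub>C\<^esub> g = i' \<cdot>\<^bsub>C\<^esub> h \<longrightarrow>
        (\<exists>!u. u \<in> Hom C X (Dom C i) \<and> i \<cdot>\<^bsub>C\<^esub> u = g \<and> f \<cdot>\<^bsub>C\<^esub> u = h))"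

definition is_bicartesian :: "('o, 'm, 'z) cat_scheme \<Rightarrow> 'm \<Rightarrow> 'm \<Rightarrow> 'm \<Rightarrow> 'm \<Rightarrow> bool" where
  "is_bicartesian C i f f' i' \<longleftrightarrow> is_pushout C i f f' i' \<and> is_pullback C i f f' i'"


section \<open>Additive categories\<close>

record ('o, 'm) acat = "('o, 'm) cat" +
  Add :: "'m \<Rightarrow> 'm \<Rightarrow> 'm"  (infixl \<open>\<boxplus>\<index>\<close> 65)
  Zero :: "'o \<Rightarrow> 'o \<Rightarrow> 'm"

text \<open>The Hom-groups are written with the multiplicative \<open>monoid\<close> record of the algebra library,
  so that \<open>inv\<close> in \<open>Hom_group C A B\<close> is the additive inverse.\<close>

definition Hom_group :: "('o, 'm, 'z) acat_scheme \<Rightarrow> 'o \<Rightarrow> 'o \<Rightarrow> 'm monoid" where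
  "Hom_group C A B = \<lparr>carrier = Hom C A B, mult = Add C, one = Zero C A B\<rparr>"

definition Neg :: "('o, 'm, 'z) acat_scheme \<Rightarrow> 'm \<Rightarrow> 'm" where
  "Neg C f = inv\<^bsub>Hom_group C (Dom C f) (Cod C f)\<^esub> f"

definition is_zero_object :: "('o, 'm, 'z) cat_scheme \<Rightarrow> 'o \<Rightarrow> bool" where
  "is_zero_object C Z \<longleftrightarrow> Z \<in> Obj C \<and>
     (\<forall>A \<in> Obj C. (\<exists>!f. f \<in> Hom C Z A) \<and> (\<exists>!f. f \<in> Hom C A Z))"

text \<open>\<open>S = A \<oplus> B\<close> with injections \<open>j\<^sub>1, j\<^sub>2\<close> and projections \<open>q\<^sub>1, q\<^sub>2\<close>.\<close>

definition is_biproduct ::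
    "('o, 'm, 'z) acat_scheme \<Rightarrow> 'o \<Rightarrow> 'o \<Rightarrow> 'o \<Rightarrow> 'm \<Rightarrow> 'm \<Rightarrow> 'm \<Rightarrow> 'm \<Rightarrow> bool" where
  "is_biproduct C A B S j\<^sub>1 j\<^sub>2 q\<^sub>1 q\<^sub>2 \<longleftrightarrow>
     A \<in> Obj C \<and> B \<in> Obj C \<and> S \<in> Obj C \<and>
     j\<^sub>1 \<in> Hom C A S \<and> j\<^sub>2 \<in> Hom C B S \<and> q\<^sub>1 \<in> Hom C S A \<and> q\<^sub>2 \<in> Hom C S B \<and>
     q\<^sub>1 \<cdot>\<^bsub>C\<^esub> j\<^sub>1 = Ident C A \<and> q\<^sub>2 \<cdot>\<^bsub>C\<^esub> j\<^sub>2 = Ident C B \<and>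
     q\<^sub>1 \<cdot>\<^bsub>C\<^esub> j\<^sub>2 = Zero C B A \<and> q\<^sub>2 \<cdot>\<^bsub>C\<^esub> j\<^sub>1 = Zero C A B \<and>
     (j\<^sub>1 \<cdot>\<^bsub>C\<^esub> q\<^sub>1) \<boxplus>\<^bsub>C\<^esub> (j\<^sub>2 \<cdot>\<^bsub>C\<^esub> q\<^sub>2) = Ident C S"

text \<open>The column \<open>[g; h] : X \<rightarrow> A \<oplus> B\<close> and the row \<open>[g h] : A \<oplus> B \<rightarrow> X\<close>, relative to the injections
  \<open>j\<^sub>1, j\<^sub>2\<close> and the projections \<open>q\<^sub>1, q\<^sub>2\<close> of a biproduct.\<close>

definition column :: "('o, 'm, 'z) acat_scheme \<Rightarrow> 'm \<Rightarrow> 'm \<Rightarrow> 'm \<Rightarrow> 'm \<Rightarrow> 'm" where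
  "column C j\<^sub>1 j\<^sub>2 g h = (j\<^sub>1 \<cdot>\<^bsub>C\<^esub> g) \<boxplus>\<^bsub>C\<^esub> (j\<^sub>2 \<cdot>\<^bsub>C\<^esub> h)"

definition row :: "('o, 'm, 'z) acat_scheme \<Rightarrow> 'm \<Rightarrow> 'm \<Rightarrow> 'm \<Rightarrow> 'm \<Rightarrow> 'm" where
  "row C q\<^sub>1 q\<^sub>2 g h = (g \<cdot>\<^bsub>C\<^esub> q\<^sub>1) \<boxplus>\<^bsub>C\<^esub> (h \<cdot>\<^bsub>C\<^esub> q\<^sub>2)"

locale additive_category = category C
  for C :: "('o, 'm, 'z) acat_scheme" (structure) +
  assumes Hom_comm_group: "\<lbrakk>A \<in> Obj C; B \<in> Obj C\<rbrakk> \<Longrightarrow> comm_group (Hom_group C A B)"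
    and Comp_Add_right:
      "\<lbrakk>f \<in> Hom C A B; g \<in> Hom C A B; h \<in> Hom C B D\<rbrakk> \<Longrightarrow> h \<cdot> (f \<boxplus> g) = (h \<cdot> f) \<boxplus> (h \<cdot> g)"
    and Comp_Add_left:
      "\<lbrakk>f \<in> Hom C A B; g \<in> Hom C B D; h \<in> Hom C B D\<rbrakk> \<Longrightarrow> (g \<boxplus> h) \<cdot> f = (g \<cdot> f) \<boxplus> (h \<cdot> f)"
    and zero_object_exists: "\<exists>Z. is_zero_object C Z"
    and biproducts_exist:
      "\<lbrakk>A \<in> Obj C; B \<in> Obj C\<rbrakk> \<Longrightarrow> \<exists>S j\<^sub>1 j\<^sub>2 q\<^sub>1 q\<^sub>2. is_biproduct C A B S j\<^sub>1 j\<^sub>2 q\<^sub>1 q\<^sub>2"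


section \<open>Exact categories\<close>

definition is_kernel :: "('o, 'm, 'z) acat_scheme \<Rightarrow> 'm \<Rightarrow> 'm \<Rightarrow> bool" where
  "is_kernel C i p \<longleftrightarrow> i \<in> Arr C \<and> p \<in> Arr C \<and> Cod C i = Dom C p \<and>
     p \<cdot>\<^bsub>C\<^esub> i = Zero C (Dom C i) (Cod C p) \<and>
     (\<forall>X \<in> Obj C. \<forall>g \<in> Hom C X (Dom C p). p \<cdot>\<^bsub>C\<^esub> g = Zero C X (Cod C p) \<longrightarrow>
        (\<exists>!u. u \<in> Hom C X (Dom C i) \<and> i \<cdot>\<^bsub>C\<^esub> u = g))"

definition is_cokernel :: "('o, 'm, 'z) acat_scheme \<Rightarrow> 'm \<Rightarrow> 'm \<Rightarrow> bool" where
  "is_cokernel C p i \<longleftrightarrow> i \<in> Arr C \<and> p \<in> Arr C \<and> Cod C i = Dom C p \<and>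
     p \<cdot>\<^bsub>C\<^esub> i = Zero C (Dom C i) (Cod C p) \<and>
     (\<forall>X \<in> Obj C. \<forall>g \<in> Hom C (Cod C i) X. g \<cdot>\<^bsub>C\<^esub> i = Zero C (Dom C i) X \<longrightarrow>
        (\<exists>!u. u \<in> Hom C (Cod C p) X \<and> u \<cdot>\<^bsub>C\<^esub> p = g))"

definition kernel_cokernel_pair :: "('o, 'm, 'z) acat_scheme \<Rightarrow> 'm \<Rightarrow> 'm \<Rightarrow> bool" where
  "kernel_cokernel_pair C i p \<longleftrightarrow> is_kernel C i p \<and> is_cokernel C p i"

definition isomorphic_pairs :: "('o, 'm, 'z) cat_scheme \<Rightarrow> 'm \<times> 'm \<Rightarrow> 'm \<times> 'm \<Rightarrow> bool" where
  "isomorphic_pairs C = (\<lambda>(i, p) (i', p').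
     (\<exists>a b c. is_iso C a \<and> is_iso C b \<and> is_iso C c \<and>
        commutative_square C i a b i' \<and> commutative_square C p b c p'))"

definition admissible_monic :: "('m \<times> 'm) set \<Rightarrow> 'm \<Rightarrow> bool" where
  "admissible_monic E i \<longleftrightarrow> (\<exists>p. (i, p) \<in> E)"

definition admissible_epic :: "('m \<times> 'm) set \<Rightarrow> 'm \<Rightarrow> bool" where
  "admissible_epic E p \<longleftrightarrow> (\<exists>i. (i, p) \<in> E)"

locale exact_category = additive_category C
  for C :: "('o, 'm, 'z) acat_scheme" (structure) +
  fixes E :: "('m \<times> 'm) set"
  assumes E_kernel_cokernel_pair: "(i, p) \<in> E \<Longrightarrow> kernel_cokernel_pair C i p"
    and E_iso_closed: "\<lbrakk>(i, p) \<in> E; isomorphic_pairs C (i, p) (i', p')\<rbrakk> \<Longrightarrow> (i', p') \<in> E"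
    and Ident_admissible_monic: "A \<in> Obj C \<Longrightarrow> admissible_monic E (Ident C A)"
    and Ident_admissible_epic: "A \<in> Obj C \<Longrightarrow> admissible_epic E (Ident C A)"
    and Comp_admissible_monic:
      "\<lbrakk>admissible_monic E i; admissible_monic E j; Cod C i = Dom C j\<rbrakk>
         \<Longrightarrow> admissible_monic E (j \<cdot> i)"
    and Comp_admissible_epic:
      "\<lbrakk>admissible_epic E p; admissible_epic E q; Cod C p = Dom C q\<rbrakk>
         \<Longrightarrow> admissible_epic E (q \<cdot> p)"
    and pushout_admissible_monic:
      "\<lbrakk>admissible_monic E i; f \<in> Arr C; Dom C f = Dom C i\<rbrakk>
         \<Longrightarrow> \<exists>f' i'. is_pushout C i f f' i' \<and> admissible_monic E i'"
    and pullback_admissible_epic: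
      "\<lbrakk>admissible_epic E p; f \<in> Arr C; Cod C f = Cod C p\<rbrakk>
         \<Longrightarrow> \<exists>p' f'. is_pullback C p' f' f p \<and> admissible_epic E p'"

end

theory Submission
  imports Defs
begin

text \<open>A commutative square is a push-out (pull-back) iff the row is a cokernel of the column (the column
  is a kernel of the row). So a push-out gives a short exact sequence once the column is an admissible
  monic, which it is as \<open>i \<oplus> 1\<close> composed with \<open>[1; -f] : A \<rightarrow> A \<oplus> A'\<close>. Conversely, if the rows
  of the diagram are exact, then \<open>B \<oplus> A'\<close> is the pull-back of \<open>p\<close> along \<open>p'\<close>, so the row
  is an admissible epic; the square is a pull-back, hence the column is its kernel.\<close>

section \<open>Categories\<close>

text \<open>The minus sign in the column turns \<open>f' \<cdot> i = i' \<cdot> f\<close> into the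
  vanishing of row after column. Assertion (ii) is the hub: it contains both universal properties,
  hence gives (iii) at once, and it can be reached from (i) as well as from (iv).

  The obstacle is that a kernel or a cokernel need not lie in \<open>E\<close>. One arrow of the
  pair has to be known as admissible; then the universal property of the other arrow determines it
  up to isomorphism, and closure under isomorphisms puts the pair into \<open>E\<close>. From (i)
  the admissible arrow is the column. From (iv) the kernel side is a direct chase, whereas no arrow
  out of \<open>B'\<close> extending a compatible pair on \<open>B\<close> and \<open>A'\<close> is
  visible in the diagram; admissibility of the row supplies it, since an admissible epic is a
  cokernel of its kernel.

  From (i) to (iv), the arrow \<open>p'\<close> is induced by \<open>p\<close> on \<open>B\<close>
  and zero on \<open>A'\<close>.\<close>

lemma HomD:
  assumes "f \<in> Hom C A B"
  shows "f \<in> Arr C" "Dom C f = A" "Cod C f = B"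
  using assms by (simp_all add: Hom_def)

context category
begin

text \<open>Typing is restated through \<open>Arr\<close>, \<open>Dom\<close> and
  \<open>Cod\<close>, so that the simplifier can discharge the side conditions of composition
  without guessing the objects of a Hom-set.\<close>

lemma Comp_arr [simp]:
  assumes "f \<in> Arr C" "g \<in> Arr C" "Cod C f = Dom C g"
  shows "g \<cdot> f \<in> Arr C" "Dom C (g \<cdot> f) = Dom C f" "Cod C (g \<cdot> f) = Cod C g"
  using Comp_in_Hom[of f "Dom C f" "Cod C f" g "Cod C g"] assms by (auto simp: Hom_def)

lemma Ident_arr [simp]:
  assumes "A \<in> Obj C"
  shows "Ident C A \<in> Arr C" "Dom C (Ident C A) = A" "Cod C (Ident C A) = A"
  using Ident_in_Hom[OF assms] by (auto simp: Hom_def)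

lemma Ident_left [simp]: "\<lbrakk>f \<in> Arr C; Cod C f = B\<rbrakk> \<Longrightarrow> Ident C B \<cdot> f = f"
  using Comp_Ident_left[of f "Dom C f" "Cod C f"] by (auto simp: Hom_def)

lemma Ident_right [simp]: "\<lbrakk>f \<in> Arr C; Dom C f = A\<rbrakk> \<Longrightarrow> f \<cdot> Ident C A = f"
  using Comp_Ident_right[of f "Dom C f" "Cod C f"] by (auto simp: Hom_def)

lemma assoc:
  "\<lbrakk>f \<in> Arr C; g \<in> Arr C; h \<in> Arr C; Cod C f = Dom C g; Cod C g = Dom C h\<rbrakk>
     \<Longrightarrow> (h \<cdot> g) \<cdot> f = h \<cdot> (g \<cdot> f)"
  using Comp_assoc[of f "Dom C f" "Cod C f" g "Cod C g" h "Cod C h"] by (auto simp: Hom_def)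

text \<open>Makes a known composite \<open>f \<cdot> g = k\<close> usable inside a right-nested
  chain, the form that rewriting with \<open>assoc\<close> produces.\<close>

lemma reassoc:
  assumes "f \<cdot> g = k" "f \<in> Arr C" "g \<in> Arr C" "h \<in> Arr C" "Cod C g = Dom C f" "Cod C h = Dom C g"
  shows "f \<cdot> (g \<cdot> h) = k \<cdot> h"
  using assms assoc[of h g f] by simp

lemma Hom_Obj:
  assumes "f \<in> Hom C A B"
  shows "A \<in> Obj C" "B \<in> Obj C"
  using assms Dom_in_Obj Cod_in_Obj by (auto simp: Hom_def)

lemma Arr_Obj [simp]:
  assumes "f \<in> Arr C"
  shows "Dom C f \<in> Obj C" "Cod C f \<in> Obj C"
  using assms Dom_in_Obj Cod_in_Obj by auto

lemma is_isoI:
  assumes "u \<in> Hom C A B" "v \<in> Hom C B A" "v \<cdot> u = Ident C A" "u \<cdot> v = Ident C B"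
  shows "is_iso C u"
  using assms by (auto simp: is_iso_def Hom_def)

lemma is_isoE:
  assumes "is_iso C u" "u \<in> Hom C A B"
  obtains v where "v \<in> Hom C B A" "v \<cdot> u = Ident C A" "u \<cdot> v = Ident C B"
  using assms by (auto simp: is_iso_def Hom_def)

lemma is_iso_Ident: "A \<in> Obj C \<Longrightarrow> is_iso C (Ident C A)"
  by (rule is_isoI[of _ A A "Ident C A"]) (auto intro: Ident_in_Hom)

text \<open>The restriction of \<open>X\<close> to objects disappears because an arrow into
  \<open>X\<close> already makes \<open>X\<close> an object. What remains mentions only the named
  corners of the square.\<close>

lemma is_pushout_iff:
  assumes "i \<in> Hom C A B" "f \<in> Hom C A A'" "f' \<in> Hom C B B'" "i' \<in> Hom C A' B'"
  shows "is_pushout C i f f' i' \<longleftrightarrow> f' \<cdot> i = i' \<cdot> f \<and>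
     (\<forall>X g h. g \<in> Hom C B X \<and> h \<in> Hom C A' X \<and> g \<cdot> i = h \<cdot> f \<longrightarrow>
        (\<exists>!u. u \<in> Hom C B' X \<and> u \<cdot> f' = g \<and> u \<cdot> i' = h))"
  using assms Hom_Obj(2)
  unfolding is_pushout_def commutative_square_def
  by (simp add: HomD[OF assms(1)] HomD[OF assms(2)] HomD[OF assms(3)] HomD[OF assms(4)]) blast

lemma is_pullback_iff:
  assumes "i \<in> Hom C A B" "f \<in> Hom C A A'" "f' \<in> Hom C B B'" "i' \<in> Hom C A' B'"
  shows "is_pullback C i f f' i' \<longleftrightarrow> f' \<cdot> i = i' \<cdot> f \<and>
     (\<forall>X g h. g \<in> Hom C X B \<and> h \<in> Hom C X A' \<and> f' \<cdot> g = i' \<cdot> h \<longrightarrow>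
        (\<exists>!u. u \<in> Hom C X A \<and> i \<cdot> u = g \<and> f \<cdot> u = h))"
  using assms Hom_Obj(1)
  unfolding is_pullback_def commutative_square_def
  by (simp add: HomD[OF assms(1)] HomD[OF assms(2)] HomD[OF assms(3)] HomD[OF assms(4)]) blast

text \<open>A composite of the two comparison arrows solves the same universal problem as an
  identity. The equation \<open>u \<cdot> k = i'\<close> is what later carries admissibility from
  \<open>k\<close> to \<open>i'\<close>.\<close>

lemma pushout_unique:
  assumes ty: "i \<in> Hom C A B" "f \<in> Hom C A A'" "f' \<in> Hom C B B'" "i' \<in> Hom C A' B'"
    "g \<in> Hom C B D" "k \<in> Hom C A' D"
    and po: "is_pushout C i f f' i'" "is_pushout C i f g k"
  obtains u where "u \<in> Hom C D B'" "is_iso C u" "u \<cdot> k = i'"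
proof -
  note P = po(1)[unfolded is_pushout_iff[OF ty(1-4)]]
  note Q = po(2)[unfolded is_pushout_iff[OF ty(1,2,5,6)]]
  obtain u where u: "u \<in> Hom C D B'" "u \<cdot> g = f'" "u \<cdot> k = i'"
    using Q P ty by metis
  obtain v where v: "v \<in> Hom C B' D" "v \<cdot> f' = g" "v \<cdot> i' = k"
    using Q P ty by metis
  note T = u(1) v(1) ty
  have vu: "v \<cdot> u \<in> Hom C D D" "(v \<cdot> u) \<cdot> g = g" "(v \<cdot> u) \<cdot> k = k"
    using T u v by (auto simp: Hom_def assoc)
  have uv: "u \<cdot> v \<in> Hom C B' B'" "(u \<cdot> v) \<cdot> f' = f'" "(u \<cdot> v) \<cdot> i' = i'"
    using T u v by (auto simp: Hom_def assoc)
  have idD: "Ident C D \<in> Hom C D D" "Ident C D \<cdot> g = g" "Ident C D \<cdot> k = k"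
    and idB: "Ident C B' \<in> Hom C B' B'" "Ident C B' \<cdot> f' = f'" "Ident C B' \<cdot> i' = i'"
    using T Hom_Obj by (auto simp: Hom_def)
  have "v \<cdot> u = Ident C D" using vu idD Q ty by metis
  moreover have "u \<cdot> v = Ident C B'" using uv idB P ty by metis
  ultimately show thesis using that u v is_isoI by metis
qed

lemma pullback_unique:
  assumes ty: "i \<in> Hom C A B" "f \<in> Hom C A A'" "f' \<in> Hom C B B'" "i' \<in> Hom C A' B'"
    "g \<in> Hom C D B" "k \<in> Hom C D A'"
    and pb: "is_pullback C i f f' i'" "is_pullback C g k f' i'"
  obtains u where "u \<in> Hom C A D" "is_iso C u" "g \<cdot> u = i"
proof -
  note P = pb(1)[unfolded is_pullback_iff[OF ty(1-4)]]
  note Q = pb(2)[unfolded is_pullback_iff[OF ty(5,6,3,4)]]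
  obtain u where u: "u \<in> Hom C A D" "g \<cdot> u = i" "k \<cdot> u = f"
    using Q P ty by metis
  obtain v where v: "v \<in> Hom C D A" "i \<cdot> v = g" "f \<cdot> v = k"
    using Q P ty by metis
  note T = u(1) v(1) ty
  have vu: "v \<cdot> u \<in> Hom C A A" "i \<cdot> (v \<cdot> u) = i" "f \<cdot> (v \<cdot> u) = f"
    using T u v by (auto simp: Hom_def assoc[symmetric])
  have uv: "u \<cdot> v \<in> Hom C D D" "g \<cdot> (u \<cdot> v) = g" "k \<cdot> (u \<cdot> v) = k"
    using T u v by (auto simp: Hom_def assoc[symmetric])
  have idA: "Ident C A \<in> Hom C A A" "i \<cdot> Ident C A = i" "f \<cdot> Ident C A = f"
    and idD: "Ident C D \<in> Hom C D D" "g \<cdot> Ident C D = g" "k \<cdot> Ident C D = k"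
    using T Hom_Obj by (auto simp: Hom_def)
  have "v \<cdot> u = Ident C A" using vu idA P ty by metis
  moreover have "u \<cdot> v = Ident C D" using uv idD Q ty by metis
  ultimately show thesis using that u v is_isoI by metis
qed

end


section \<open>Additive categories\<close>

context additive_category
begin

section \<open>Arithmetic in the Hom-groups\<close>

lemma Hom_group_comm_group:
  assumes "f \<in> Arr C"
  shows "comm_group (Hom_group C (Dom C f) (Cod C f))"
  using Hom_comm_group assms by simp

lemma Add_arr [simp]:
  assumes "f \<in> Arr C" "g \<in> Arr C" "Dom C g = Dom C f" "Cod C g = Cod C f"
  shows "f \<boxplus> g \<in> Arr C" "Dom C (f \<boxplus> g) = Dom C f" "Cod C (f \<boxplus> g) = Cod C f"
proof -
  interpret comm_group "Hom_group C (Dom C f) (Cod C f)"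
    using Hom_group_comm_group assms by blast
  show "f \<boxplus> g \<in> Arr C" "Dom C (f \<boxplus> g) = Dom C f" "Cod C (f \<boxplus> g) = Cod C f"
    using m_closed[of f g] assms by (auto simp: Hom_group_def Hom_def)
qed

lemma Zero_arr [simp]:
  assumes "A \<in> Obj C" "B \<in> Obj C"
  shows "Zero C A B \<in> Arr C" "Dom C (Zero C A B) = A" "Cod C (Zero C A B) = B"
proof -
  interpret comm_group "Hom_group C A B"
    using Hom_comm_group assms by blast
  show "Zero C A B \<in> Arr C" "Dom C (Zero C A B) = A" "Cod C (Zero C A B) = B"
    using one_closed by (auto simp: Hom_group_def Hom_def)
qed

lemma Neg_arr [simp]:
  assumes "f \<in> Arr C"
  shows "Neg C f \<in> Arr C" "Dom C (Neg C f) = Dom C f" "Cod C (Neg C f) = Cod C f"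
proof -
  interpret comm_group "Hom_group C (Dom C f) (Cod C f)"
    using Hom_group_comm_group assms by blast
  show "Neg C f \<in> Arr C" "Dom C (Neg C f) = Dom C f" "Cod C (Neg C f) = Cod C f"
    using inv_closed[of f] assms by (auto simp: Neg_def Hom_group_def Hom_def)
qed

lemma Add_Zero [simp]:
  assumes "f \<in> Arr C" "Dom C f = A" "Cod C f = B"
  shows "f \<boxplus> Zero C A B = f" "Zero C A B \<boxplus> f = f"
proof -
  interpret comm_group "Hom_group C (Dom C f) (Cod C f)"
    using Hom_group_comm_group assms by blast
  show "f \<boxplus> Zero C A B = f" "Zero C A B \<boxplus> f = f"
    using r_one[of f] l_one[of f] assms by (auto simp: Hom_group_def Hom_def)
qed

lemma Add_assoc:
  assumes "f \<in> Arr C" "g \<in> Arr C" "h \<in> Arr C" "Dom C g = Dom C f" "Cod C g = Cod C f"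
    "Dom C h = Dom C f" "Cod C h = Cod C f"
  shows "(f \<boxplus> g) \<boxplus> h = f \<boxplus> (g \<boxplus> h)"
proof -
  interpret comm_group "Hom_group C (Dom C f) (Cod C f)"
    using Hom_group_comm_group assms by blast
  show ?thesis
    using m_assoc[of f g h] assms by (auto simp: Hom_group_def Hom_def)
qed

lemma Add_commute:
  assumes "f \<in> Arr C" "g \<in> Arr C" "Dom C g = Dom C f" "Cod C g = Cod C f"
  shows "f \<boxplus> g = g \<boxplus> f"
proof -
  interpret comm_group "Hom_group C (Dom C f) (Cod C f)"
    using Hom_group_comm_group assms by blast
  show ?thesis
    using m_comm[of f g] assms by (auto simp: Hom_group_def Hom_def)
qed

lemma Add_Neg [simp]:
  assumes "f \<in> Arr C"
  shows "f \<boxplus> Neg C f = Zero C (Dom C f) (Cod C f)" "Neg C f \<boxplus> f = Zero C (Dom C f) (Cod C f)"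
proof -
  interpret comm_group "Hom_group C (Dom C f) (Cod C f)"
    using Hom_group_comm_group assms by blast
  show "f \<boxplus> Neg C f = Zero C (Dom C f) (Cod C f)"
    "Neg C f \<boxplus> f = Zero C (Dom C f) (Cod C f)"
    using r_inv[of f] l_inv[of f] assms by (auto simp: Neg_def Hom_group_def Hom_def)
qed

lemma Add_left_cancel:
  assumes "f \<in> Arr C" "g \<in> Arr C" "h \<in> Arr C" "Dom C g = Dom C f" "Cod C g = Cod C f"
    "Dom C h = Dom C f" "Cod C h = Cod C f"
  shows "f \<boxplus> g = f \<boxplus> h \<longleftrightarrow> g = h"
proof -
  interpret comm_group "Hom_group C (Dom C f) (Cod C f)"
    using Hom_group_comm_group assms by blast
  show ?thesis
    using Units_l_cancel[of f g h] assms unfolding Units_eq by (auto simp: Hom_group_def Hom_def)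
qed

lemma Comp_Add [simp]:
  assumes "f \<in> Arr C" "g \<in> Arr C" "h \<in> Arr C" "Dom C g = Dom C f" "Cod C g = Cod C f"
  shows "Cod C f = Dom C h \<Longrightarrow> h \<cdot> (f \<boxplus> g) = (h \<cdot> f) \<boxplus> (h \<cdot> g)"
    and "Cod C h = Dom C f \<Longrightarrow> (f \<boxplus> g) \<cdot> h = (f \<cdot> h) \<boxplus> (g \<cdot> h)"
  using assms Comp_Add_right[of f "Dom C f" "Cod C f" g h "Cod C h"]
    Comp_Add_left[of h "Dom C h" "Cod C h" f "Cod C f" g]
  by (auto simp: Hom_def)

text \<open>That composition preserves zero is not an axiom. Bilinearity makes a composite with zero
  idempotent under addition, and a group has no idempotent but its neutral element.\<close>

lemma Add_idem_Zero:
  assumes "f \<in> Arr C" "f \<boxplus> f = f"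
  shows "f = Zero C (Dom C f) (Cod C f)"
  using Add_left_cancel[of f f "Zero C (Dom C f) (Cod C f)"] assms by simp

lemma Comp_Zero_right [simp]:
  assumes "h \<in> Arr C" "Dom C h = B" "A \<in> Obj C"
  shows "h \<cdot> Zero C A B = Zero C A (Cod C h)"
proof -
  have B: "B \<in> Obj C" using assms by auto
  have "h \<cdot> Zero C A B \<boxplus> h \<cdot> Zero C A B = h \<cdot> (Zero C A B \<boxplus> Zero C A B)"
    using assms B by (subst Comp_Add(1)) auto
  also have "\<dots> = h \<cdot> Zero C A B" using assms B by simp
  finally show ?thesis using Add_idem_Zero[of "h \<cdot> Zero C A B"] assms B by simp
qed

lemma Comp_Zero_left [simp]:
  assumes "h \<in> Arr C" "Cod C h = A" "B \<in> Obj C"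
  shows "Zero C A B \<cdot> h = Zero C (Dom C h) B"
proof -
  have A: "A \<in> Obj C" using assms by auto
  have "Zero C A B \<cdot> h \<boxplus> Zero C A B \<cdot> h = (Zero C A B \<boxplus> Zero C A B) \<cdot> h"
    using assms A by (subst Comp_Add(2)) auto
  also have "\<dots> = Zero C A B \<cdot> h" using assms A by simp
  finally show ?thesis using Add_idem_Zero[of "Zero C A B \<cdot> h"] assms A by simp
qed

text \<open>Uniqueness of additive inverses; through it bilinearity yields the rules for
  \<open>Neg\<close> and composition.\<close>

lemma Add_eq_Zero_iff:
  assumes "f \<in> Arr C" "g \<in> Arr C" "Dom C g = Dom C f" "Cod C g = Cod C f"
  shows "f \<boxplus> g = Zero C (Dom C f) (Cod C f) \<longleftrightarrow> g = Neg C f"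
  using assms Add_left_cancel[of f g "Neg C f"] by simp

lemma Neg_Neg [simp]: "f \<in> Arr C \<Longrightarrow> Neg C (Neg C f) = f"
  using Add_eq_Zero_iff[of "Neg C f" f] by simp

lemma Neg_eq_iff: "\<lbrakk>f \<in> Arr C; g \<in> Arr C\<rbrakk> \<Longrightarrow> Neg C f = g \<longleftrightarrow> f = Neg C g"
  using Neg_Neg by metis

lemma diff_eq_Zero_iff:
  assumes "f \<in> Arr C" "g \<in> Arr C" "Dom C f = A" "Cod C f = B" "Dom C g = A" "Cod C g = B"
  shows "f \<boxplus> Neg C g = Zero C A B \<longleftrightarrow> f = g"
proof -
  have "f \<boxplus> Neg C g = Zero C A B \<longleftrightarrow> Neg C g = Neg C f"
    using assms Add_eq_Zero_iff[of f "Neg C g"] by simp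
  also have "\<dots> \<longleftrightarrow> f = g" using Neg_Neg assms by metis
  finally show ?thesis .
qed

lemma Comp_Neg_right [simp]:
  assumes "f \<in> Arr C" "h \<in> Arr C" "Cod C f = Dom C h"
  shows "h \<cdot> Neg C f = Neg C (h \<cdot> f)"
proof -
  have "h \<cdot> f \<boxplus> h \<cdot> Neg C f = h \<cdot> (f \<boxplus> Neg C f)"
    using assms by (subst Comp_Add(1)) auto
  also have "\<dots> = Zero C (Dom C f) (Cod C h)" using assms by simp
  finally show ?thesis
    using assms Add_eq_Zero_iff[of "h \<cdot> f" "h \<cdot> Neg C f"] by simp
qed

lemma Comp_Neg_left [simp]:
  assumes "f \<in> Arr C" "h \<in> Arr C" "Cod C h = Dom C f"
  shows "Neg C f \<cdot> h = Neg C (f \<cdot> h)"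
proof -
  have "f \<cdot> h \<boxplus> Neg C f \<cdot> h = (f \<boxplus> Neg C f) \<cdot> h"
    using assms by (subst Comp_Add(2)) auto
  also have "\<dots> = Zero C (Dom C h) (Cod C f)" using assms by simp
  finally show ?thesis
    using assms Add_eq_Zero_iff[of "f \<cdot> h" "Neg C f \<cdot> h"] by simp
qed

section \<open>Kernels and cokernels\<close>

lemma is_kernel_iff:
  assumes "i \<in> Hom C A B" "p \<in> Hom C B D"
  shows "is_kernel C i p \<longleftrightarrow> p \<cdot> i = Zero C A D \<and>
     (\<forall>X g. g \<in> Hom C X B \<and> p \<cdot> g = Zero C X D \<longrightarrow> (\<exists>!u. u \<in> Hom C X A \<and> i \<cdot> u = g))"
  using assms Hom_Obj(1) unfolding is_kernel_def
  by (simp add: HomD[OF assms(1)] HomD[OF assms(2)]) blast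

lemma is_cokernel_iff:
  assumes "i \<in> Hom C A B" "p \<in> Hom C B D"
  shows "is_cokernel C p i \<longleftrightarrow> p \<cdot> i = Zero C A D \<and>
     (\<forall>X g. g \<in> Hom C B X \<and> g \<cdot> i = Zero C A X \<longrightarrow> (\<exists>!u. u \<in> Hom C D X \<and> u \<cdot> p = g))"
  using assms Hom_Obj(2) unfolding is_cokernel_def
  by (simp add: HomD[OF assms(1)] HomD[OF assms(2)]) blast

text \<open>The arrow \<open>i \<cdot> u\<close> is itself annihilated by \<open>p\<close>, so the
  uniqueness half of the kernel property applies to it.\<close>

lemma kernel_monic:
  assumes "is_kernel C i p" "i \<in> Hom C A B" "p \<in> Hom C B D"
    and "u \<in> Hom C X A" "v \<in> Hom C X A" "i \<cdot> u = i \<cdot> v"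
  shows "u = v"
proof -
  note K = assms(1)[unfolded is_kernel_iff[OF assms(2,3)]]
  have g: "i \<cdot> u \<in> Hom C X B" using assms by (auto simp: Hom_def)
  have "p \<cdot> (i \<cdot> u) = (p \<cdot> i) \<cdot> u" using assms(1-5) by (simp add: Hom_def assoc)
  also have "\<dots> = Zero C X D" using K assms Hom_Obj by (auto simp: Hom_def)
  finally have "\<exists>!w. w \<in> Hom C X A \<and> i \<cdot> w = i \<cdot> u" using K g by blast
  then show ?thesis using assms by metis
qed

lemma cokernel_epic:
  assumes "is_cokernel C p i" "i \<in> Hom C A B" "p \<in> Hom C B D"
    and "u \<in> Hom C D X" "v \<in> Hom C D X" "u \<cdot> p = v \<cdot> p"
  shows "u = v"
proof -
  note K = assms(1)[unfolded is_cokernel_iff[OF assms(2,3)]]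
  have g: "u \<cdot> p \<in> Hom C B X" using assms by (auto simp: Hom_def)
  have "(u \<cdot> p) \<cdot> i = u \<cdot> (p \<cdot> i)" using assms(1-5) by (simp add: Hom_def assoc)
  also have "\<dots> = Zero C A X" using K assms Hom_Obj by (auto simp: Hom_def)
  finally have "\<exists>!w. w \<in> Hom C D X \<and> w \<cdot> p = u \<cdot> p" using K g by blast
  then show ?thesis using assms by metis
qed

lemma cokernel_unique:
  assumes ty: "i \<in> Hom C A B" "p \<in> Hom C B D" "q \<in> Hom C B F"
    and ck: "is_cokernel C p i" "is_cokernel C q i"
  obtains u where "u \<in> Hom C D F" "is_iso C u" "u \<cdot> p = q"
proof -
  note P = ck(1)[unfolded is_cokernel_iff[OF ty(1,2)]]
  note Q = ck(2)[unfolded is_cokernel_iff[OF ty(1,3)]]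
  obtain u where u: "u \<in> Hom C D F" "u \<cdot> p = q" using P Q ty by metis
  obtain v where v: "v \<in> Hom C F D" "v \<cdot> q = p" using P Q ty by metis
  have "v \<cdot> u = Ident C D"
    by (rule cokernel_epic[OF ck(1) ty(1,2)]) (use u v ty Hom_Obj in \<open>auto simp: Hom_def assoc\<close>)
  moreover have "u \<cdot> v = Ident C F"
    by (rule cokernel_epic[OF ck(2) ty(1,3)]) (use u v ty Hom_Obj in \<open>auto simp: Hom_def assoc\<close>)
  ultimately show thesis using that u v is_isoI by metis
qed

lemma kernel_unique:
  assumes ty: "i \<in> Hom C A B" "j \<in> Hom C D B" "p \<in> Hom C B F"
    and k: "is_kernel C i p" "is_kernel C j p"
  obtains u where "u \<in> Hom C A D" "is_iso C u" "j \<cdot> u = i"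
proof -
  note P = k(1)[unfolded is_kernel_iff[OF ty(1,3)]]
  note Q = k(2)[unfolded is_kernel_iff[OF ty(2,3)]]
  obtain u where u: "u \<in> Hom C A D" "j \<cdot> u = i" using P Q ty by metis
  obtain v where v: "v \<in> Hom C D A" "i \<cdot> v = j" using P Q ty by metis
  note T = HomD[OF u(1)] HomD[OF v(1)] HomD[OF ty(1)] HomD[OF ty(2)]
  have "i \<cdot> (v \<cdot> u) = i \<cdot> Ident C A" "j \<cdot> (u \<cdot> v) = j \<cdot> Ident C D"
    using T u(2) v(2) reassoc[of i v j u] reassoc[of j u i v] by simp_all
  moreover have "v \<cdot> u \<in> Hom C A A" "u \<cdot> v \<in> Hom C D D"
    "Ident C A \<in> Hom C A A" "Ident C D \<in> Hom C D D"
    using T Hom_Obj[OF u(1)] by (simp_all add: Hom_def)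
  ultimately have "v \<cdot> u = Ident C A" "u \<cdot> v = Ident C D"
    using kernel_monic[OF k(1) ty(1,3)] kernel_monic[OF k(2) ty(2,3)] by blast+
  then show thesis using that u v is_isoI by metis
qed

end

section \<open>Biproducts and their matrix calculus\<close>

locale biproduct = additive_category C
  for C :: "('o, 'm, 'z) acat_scheme" (structure) +
  fixes A B S :: 'o and j\<^sub>1 j\<^sub>2 q\<^sub>1 q\<^sub>2 :: 'm
  assumes is_biproduct: "is_biproduct C A B S j\<^sub>1 j\<^sub>2 q\<^sub>1 q\<^sub>2"
begin

lemma biproduct_Obj [simp]: "A \<in> Obj C" "B \<in> Obj C" "S \<in> Obj C"
  using is_biproduct by (auto simp: is_biproduct_def)

lemma biproduct_arr [simp]:
  "j\<^sub>1 \<in> Arr C" "Dom C j\<^sub>1 = A" "Cod C j\<^sub>1 = S"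
  "j\<^sub>2 \<in> Arr C" "Dom C j\<^sub>2 = B" "Cod C j\<^sub>2 = S"
  "q\<^sub>1 \<in> Arr C" "Dom C q\<^sub>1 = S" "Cod C q\<^sub>1 = A"
  "q\<^sub>2 \<in> Arr C" "Dom C q\<^sub>2 = S" "Cod C q\<^sub>2 = B"
  using is_biproduct by (auto simp: is_biproduct_def Hom_def)

lemma proj_inj [simp]:
  "q\<^sub>1 \<cdot> j\<^sub>1 = Ident C A" "q\<^sub>2 \<cdot> j\<^sub>2 = Ident C B" "q\<^sub>1 \<cdot> j\<^sub>2 = Zero C B A" "q\<^sub>2 \<cdot> j\<^sub>1 = Zero C A B"
  using is_biproduct by (auto simp: is_biproduct_def)

lemma inj_proj: "j\<^sub>1 \<cdot> q\<^sub>1 \<boxplus> j\<^sub>2 \<cdot> q\<^sub>2 = Ident C S"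
  using is_biproduct by (auto simp: is_biproduct_def)

text \<open>The equations \<open>proj_inj\<close> for right-nested composites, where a projection no
  longer stands directly against an injection.\<close>

lemma proj_inj_comp [simp]:
  assumes "x \<in> Arr C"
  shows "Cod C x = A \<Longrightarrow> q\<^sub>1 \<cdot> (j\<^sub>1 \<cdot> x) = x" "Cod C x = B \<Longrightarrow> q\<^sub>2 \<cdot> (j\<^sub>2 \<cdot> x) = x"
    "Cod C x = B \<Longrightarrow> q\<^sub>1 \<cdot> (j\<^sub>2 \<cdot> x) = Zero C (Dom C x) A"
    "Cod C x = A \<Longrightarrow> q\<^sub>2 \<cdot> (j\<^sub>1 \<cdot> x) = Zero C (Dom C x) B"
  using assms by (simp_all add: assoc[symmetric])

lemma column_arr [simp]:
  assumes "g \<in> Arr C" "h \<in> Arr C" "Cod C g = A" "Cod C h = B" "Dom C h = Dom C g"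
  shows "column C j\<^sub>1 j\<^sub>2 g h \<in> Arr C" "Dom C (column C j\<^sub>1 j\<^sub>2 g h) = Dom C g"
    "Cod C (column C j\<^sub>1 j\<^sub>2 g h) = S"
  using assms by (simp_all add: column_def)

lemma row_arr [simp]:
  assumes "g \<in> Arr C" "h \<in> Arr C" "Dom C g = A" "Dom C h = B" "Cod C h = Cod C g"
  shows "row C q\<^sub>1 q\<^sub>2 g h \<in> Arr C" "Cod C (row C q\<^sub>1 q\<^sub>2 g h) = Cod C g"
    "Dom C (row C q\<^sub>1 q\<^sub>2 g h) = S"
  using assms by (simp_all add: row_def)

lemma proj_column [simp]:
  assumes "g \<in> Arr C" "h \<in> Arr C" "Cod C g = A" "Cod C h = B" "Dom C h = Dom C g"
  shows "q\<^sub>1 \<cdot> column C j\<^sub>1 j\<^sub>2 g h = g" "q\<^sub>2 \<cdot> column C j\<^sub>1 j\<^sub>2 g h = h"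
  using assms by (simp_all add: column_def)

lemma row_inj [simp]:
  assumes "g \<in> Arr C" "h \<in> Arr C" "Dom C g = A" "Dom C h = B" "Cod C h = Cod C g"
  shows "row C q\<^sub>1 q\<^sub>2 g h \<cdot> j\<^sub>1 = g" "row C q\<^sub>1 q\<^sub>2 g h \<cdot> j\<^sub>2 = h"
  using assms by (simp_all add: row_def assoc)

lemma comp_column:
  assumes "g \<in> Arr C" "h \<in> Arr C" "Cod C g = A" "Cod C h = B" "Dom C h = Dom C g"
    and "u \<in> Arr C" "Dom C u = S"
  shows "u \<cdot> column C j\<^sub>1 j\<^sub>2 g h = (u \<cdot> j\<^sub>1) \<cdot> g \<boxplus> (u \<cdot> j\<^sub>2) \<cdot> h"
  using assms by (simp add: column_def assoc)

lemma row_comp: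
  assumes "g \<in> Arr C" "h \<in> Arr C" "Dom C g = A" "Dom C h = B" "Cod C h = Cod C g"
    and "u \<in> Arr C" "Cod C u = S"
  shows "row C q\<^sub>1 q\<^sub>2 g h \<cdot> u = g \<cdot> (q\<^sub>1 \<cdot> u) \<boxplus> h \<cdot> (q\<^sub>2 \<cdot> u)"
  using assms by (simp add: row_def assoc)

text \<open>Composing the decomposition \<open>inj_proj\<close> of the identity with an arrow
  rebuilds that arrow from its two components.\<close>

lemma eq_iff_proj:
  assumes "u \<in> Arr C" "v \<in> Arr C" "Cod C u = S" "Cod C v = S" "Dom C v = Dom C u"
  shows "u = v \<longleftrightarrow> q\<^sub>1 \<cdot> u = q\<^sub>1 \<cdot> v \<and> q\<^sub>2 \<cdot> u = q\<^sub>2 \<cdot> v"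
proof -
  have *: "w = j\<^sub>1 \<cdot> (q\<^sub>1 \<cdot> w) \<boxplus> j\<^sub>2 \<cdot> (q\<^sub>2 \<cdot> w)" if "w \<in> Arr C" "Cod C w = S" for w
    using that inj_proj Comp_Add(2)[of "j\<^sub>1 \<cdot> q\<^sub>1" "j\<^sub>2 \<cdot> q\<^sub>2" w] by (simp add: assoc)
  show ?thesis using *[of u] *[of v] assms by metis
qed

lemma eq_iff_inj:
  assumes "u \<in> Arr C" "v \<in> Arr C" "Dom C u = S" "Dom C v = S" "Cod C v = Cod C u"
  shows "u = v \<longleftrightarrow> u \<cdot> j\<^sub>1 = v \<cdot> j\<^sub>1 \<and> u \<cdot> j\<^sub>2 = v \<cdot> j\<^sub>2"
proof -
  have *: "w = (w \<cdot> j\<^sub>1) \<cdot> q\<^sub>1 \<boxplus> (w \<cdot> j\<^sub>2) \<cdot> q\<^sub>2" if "w \<in> Arr C" "Dom C w = S" for w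
    using that inj_proj Comp_Add(1)[of "j\<^sub>1 \<cdot> q\<^sub>1" "j\<^sub>2 \<cdot> q\<^sub>2" w] by (simp add: assoc)
  show ?thesis using *[of u] *[of v] assms by metis
qed

text \<open>An arrow \<open>k\<close> out of \<open>S\<close> is the same as the pair of its
  restrictions along \<open>j\<^sub>1\<close> and \<open>j\<^sub>2\<close>. Under this
  correspondence \<open>k\<close> annihilates the column iff the pair is compatible with
  \<open>i\<close> and \<open>f\<close>, and \<open>k\<close> factors through the row by
  \<open>u\<close> iff \<open>u\<close> solves the push-out problem for the pair. Hence the two
  universal properties coincide.\<close>

lemma is_pushout_iff_is_cokernel:
  assumes ty: "i \<in> Hom C X A" "f \<in> Hom C X B" "f' \<in> Hom C A Y" "i' \<in> Hom C B Y"
  shows "is_pushout C i f f' i' \<longleftrightarrow>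
    is_cokernel C (row C q\<^sub>1 q\<^sub>2 f' i') (column C j\<^sub>1 j\<^sub>2 i (Neg C f))"
proof -
  define c where "c = column C j\<^sub>1 j\<^sub>2 i (Neg C f)"
  define r where "r = row C q\<^sub>1 q\<^sub>2 f' i'"
  note T = HomD[OF ty(1)] HomD[OF ty(2)] HomD[OF ty(3)] HomD[OF ty(4)]
  have Hom: "c \<in> Hom C X S" "r \<in> Hom C S Y"
    using T by (auto simp: c_def r_def Hom_def)
  have r: "r \<cdot> j\<^sub>1 = f'" "r \<cdot> j\<^sub>2 = i'" using T by (auto simp: r_def)
  have zero: "k \<cdot> c = Zero C X Z \<longleftrightarrow> (k \<cdot> j\<^sub>1) \<cdot> i = (k \<cdot> j\<^sub>2) \<cdot> f" if "k \<in> Hom C S Z" for k Z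
    using HomD[OF that] T by (simp add: c_def comp_column diff_eq_Zero_iff)
  have fac: "u \<cdot> r = k \<longleftrightarrow> u \<cdot> f' = k \<cdot> j\<^sub>1 \<and> u \<cdot> i' = k \<cdot> j\<^sub>2"
    if "u \<in> Hom C Y Z" "k \<in> Hom C S Z" for u k Z
    using HomD[OF that(1)] HomD[OF that(2)] HomD[OF Hom(2)] by (simp add: eq_iff_inj assoc r)
  have row: "row C q\<^sub>1 q\<^sub>2 g h \<in> Hom C S Z" "row C q\<^sub>1 q\<^sub>2 g h \<cdot> j\<^sub>1 = g"
    "row C q\<^sub>1 q\<^sub>2 g h \<cdot> j\<^sub>2 = h" if "g \<in> Hom C A Z" "h \<in> Hom C B Z" for g h Z
    using HomD[OF that(1)] HomD[OF that(2)] by (auto simp: Hom_def)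
  have inj: "k \<cdot> j\<^sub>1 \<in> Hom C A Z" "k \<cdot> j\<^sub>2 \<in> Hom C B Z" if "k \<in> Hom C S Z" for k Z
    using that by (auto simp: Hom_def)
  \<comment> \<open>Commutativity of the square is the instance \<open>k = r\<close> of
    \<open>zero\<close>.\<close>
  have sq: "r \<cdot> c = Zero C X Y \<longleftrightarrow> f' \<cdot> i = i' \<cdot> f" using zero[OF Hom(2)] r by simp
  show ?thesis
    unfolding c_def[symmetric] r_def[symmetric] is_pushout_iff[OF ty] is_cokernel_iff[OF Hom] sq
  proof (intro conj_cong[OF refl] iffI allI impI; elim conjE)
    fix Z k
    assume po: "\<forall>Z g h. g \<in> Hom C A Z \<and> h \<in> Hom C B Z \<and> g \<cdot> i = h \<cdot> f \<longrightarrow>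
        (\<exists>!u. u \<in> Hom C Y Z \<and> u \<cdot> f' = g \<and> u \<cdot> i' = h)"
      and k: "k \<in> Hom C S Z" "k \<cdot> c = Zero C X Z"
    have "\<exists>!u. u \<in> Hom C Y Z \<and> u \<cdot> f' = k \<cdot> j\<^sub>1 \<and> u \<cdot> i' = k \<cdot> j\<^sub>2"
      using po inj[OF k(1)] zero[OF k(1)] k(2) by simp
    then show "\<exists>!u. u \<in> Hom C Y Z \<and> u \<cdot> r = k" using fac[OF _ k(1)] by (simp cong: conj_cong)
  next
    fix Z g h
    assume ck: "\<forall>Z k. k \<in> Hom C S Z \<and> k \<cdot> c = Zero C X Z \<longrightarrow> (\<exists>!u. u \<in> Hom C Y Z \<and> u \<cdot> r = k)"
      and gh: "g \<in> Hom C A Z" "h \<in> Hom C B Z" "g \<cdot> i = h \<cdot> f"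
    note k = row[OF gh(1,2)]
    have "\<exists>!u. u \<in> Hom C Y Z \<and> u \<cdot> r = row C q\<^sub>1 q\<^sub>2 g h"
      using ck zero[OF k(1)] k gh(3) by simp
    then show "\<exists>!u. u \<in> Hom C Y Z \<and> u \<cdot> f' = g \<and> u \<cdot> i' = h"
      using fac[OF _ k(1)] k(2,3) by (simp cong: conj_cong)
  qed
qed

text \<open>Arrows into \<open>S\<close> again correspond to pairs, but the sign sits in the column,
  which is now the universal arrow. A compatible pair \<open>g\<close>, \<open>h\<close> therefore
  corresponds to the column of \<open>g\<close> and \<open>Neg C h\<close>, and \<open>k\<close> to
  the pair of \<open>q\<^sub>1 \<cdot> k\<close> and
  \<open>Neg C (q\<^sub>2 \<cdot> k)\<close>.\<close>

lemma is_pullback_iff_is_kernel: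
  assumes ty: "i \<in> Hom C X A" "f \<in> Hom C X B" "f' \<in> Hom C A Y" "i' \<in> Hom C B Y"
  shows "is_pullback C i f f' i' \<longleftrightarrow>
    is_kernel C (column C j\<^sub>1 j\<^sub>2 i (Neg C f)) (row C q\<^sub>1 q\<^sub>2 f' i')"
proof -
  define c where "c = column C j\<^sub>1 j\<^sub>2 i (Neg C f)"
  define r where "r = row C q\<^sub>1 q\<^sub>2 f' i'"
  note T = HomD[OF ty(1)] HomD[OF ty(2)] HomD[OF ty(3)] HomD[OF ty(4)]
  have Hom: "c \<in> Hom C X S" "r \<in> Hom C S Y"
    using T by (auto simp: c_def r_def Hom_def)
  have c: "q\<^sub>1 \<cdot> c = i" "q\<^sub>2 \<cdot> c = Neg C f" using T by (auto simp: c_def)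
  have zero: "r \<cdot> k = Zero C Z Y \<longleftrightarrow> f' \<cdot> (q\<^sub>1 \<cdot> k) = i' \<cdot> Neg C (q\<^sub>2 \<cdot> k)"
    if "k \<in> Hom C Z S" for k Z
    using HomD[OF that] T diff_eq_Zero_iff[of "f' \<cdot> (q\<^sub>1 \<cdot> k)" "i' \<cdot> Neg C (q\<^sub>2 \<cdot> k)" Z Y]
    by (simp add: r_def row_comp)
  have fac: "c \<cdot> u = k \<longleftrightarrow> i \<cdot> u = q\<^sub>1 \<cdot> k \<and> f \<cdot> u = Neg C (q\<^sub>2 \<cdot> k)"
    if "u \<in> Hom C Z X" "k \<in> Hom C Z S" for u k Z
    using HomD[OF that(1)] HomD[OF that(2)] HomD[OF Hom(1)] T
    by (simp add: eq_iff_proj assoc[symmetric] c Neg_eq_iff)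
  have col: "column C j\<^sub>1 j\<^sub>2 g (Neg C h) \<in> Hom C Z S" "q\<^sub>1 \<cdot> column C j\<^sub>1 j\<^sub>2 g (Neg C h) = g"
    "Neg C (q\<^sub>2 \<cdot> column C j\<^sub>1 j\<^sub>2 g (Neg C h)) = h"
    if "g \<in> Hom C Z A" "h \<in> Hom C Z B" for g h Z
    using HomD[OF that(1)] HomD[OF that(2)] by (auto simp: Hom_def)
  have proj: "q\<^sub>1 \<cdot> k \<in> Hom C Z A" "Neg C (q\<^sub>2 \<cdot> k) \<in> Hom C Z B" if "k \<in> Hom C Z S" for k Z
    using that by (auto simp: Hom_def)
  have sq: "r \<cdot> c = Zero C X Y \<longleftrightarrow> f' \<cdot> i = i' \<cdot> f" using zero[OF Hom(1)] c T by simp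
  show ?thesis
    unfolding c_def[symmetric] r_def[symmetric] is_pullback_iff[OF ty] is_kernel_iff[OF Hom] sq
  proof (intro conj_cong[OF refl] iffI allI impI; elim conjE)
    fix Z k
    assume pb: "\<forall>Z g h. g \<in> Hom C Z A \<and> h \<in> Hom C Z B \<and> f' \<cdot> g = i' \<cdot> h \<longrightarrow>
        (\<exists>!u. u \<in> Hom C Z X \<and> i \<cdot> u = g \<and> f \<cdot> u = h)"
      and k: "k \<in> Hom C Z S" "r \<cdot> k = Zero C Z Y"
    have "\<exists>!u. u \<in> Hom C Z X \<and> i \<cdot> u = q\<^sub>1 \<cdot> k \<and> f \<cdot> u = Neg C (q\<^sub>2 \<cdot> k)"
      using pb proj[OF k(1)] zero[OF k(1)] k(2) by blast
    then show "\<exists>!u. u \<in> Hom C Z X \<and> c \<cdot> u = k" using fac[OF _ k(1)] by (simp cong: conj_cong)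
  next
    fix Z g h
    assume ker: "\<forall>Z k. k \<in> Hom C Z S \<and> r \<cdot> k = Zero C Z Y \<longrightarrow> (\<exists>!u. u \<in> Hom C Z X \<and> c \<cdot> u = k)"
      and gh: "g \<in> Hom C Z A" "h \<in> Hom C Z B" "f' \<cdot> g = i' \<cdot> h"
    note k = col[OF gh(1,2)]
    have "r \<cdot> column C j\<^sub>1 j\<^sub>2 g (Neg C h) = Zero C Z Y"
      unfolding zero[OF k(1)] k(2,3) by (rule gh(3))
    then have "\<exists>!u. u \<in> Hom C Z X \<and> c \<cdot> u = column C j\<^sub>1 j\<^sub>2 g (Neg C h)"
      using ker k(1) by blast
    then show "\<exists>!u. u \<in> Hom C Z X \<and> i \<cdot> u = g \<and> f \<cdot> u = h"
      unfolding fac[OF _ k(1), unfolded k(2,3)] using fac[OF _ k(1), unfolded k(2,3)]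
      by (simp cong: conj_cong)
  qed
qed

end


section \<open>Exact categories\<close>

context exact_category
begin

section \<open>Transport of admissibility along isomorphisms\<close>

lemma E_isoI:
  assumes E: "(i, p) \<in> E" and ty: "i \<in> Hom C A B" "p \<in> Hom C B D"
    and ty': "i' \<in> Hom C A' B'" "p' \<in> Hom C B' D'"
    and abc: "a \<in> Hom C A A'" "b \<in> Hom C B B'" "c \<in> Hom C D D'"
      "is_iso C a" "is_iso C b" "is_iso C c"
    and sq: "b \<cdot> i = i' \<cdot> a" "c \<cdot> p = p' \<cdot> b"
  shows "(i', p') \<in> E"
proof -
  have "commutative_square C i a b i'" "commutative_square C p b c p'"
    using ty ty' abc sq by (auto simp: commutative_square_def Hom_def)
  then have "isomorphic_pairs C (i, p) (i', p')"
    using abc by (auto simp: isomorphic_pairs_def)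
  then show ?thesis using E_iso_closed E by blast
qed

lemma E_types:
  assumes "(i, p) \<in> E"
  shows "i \<in> Hom C (Dom C i) (Cod C i)" "p \<in> Hom C (Cod C i) (Cod C p)"
proof -
  have "i \<in> Arr C \<and> p \<in> Arr C \<and> Cod C i = Dom C p"
    using E_kernel_cokernel_pair[OF assms] by (simp add: kernel_cokernel_pair_def is_kernel_def)
  then show "i \<in> Hom C (Dom C i) (Cod C i)" "p \<in> Hom C (Cod C i) (Cod C p)"
    by (simp_all add: Hom_def)
qed

lemma E_is_kernel: "(i, p) \<in> E \<Longrightarrow> is_kernel C i p"
  and E_is_cokernel: "(i, p) \<in> E \<Longrightarrow> is_cokernel C p i"
  using E_kernel_cokernel_pair by (auto simp: kernel_cokernel_pair_def)

text \<open>Admissibility provides only some partner \<open>p\<close>. Since \<open>p\<close> and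
  \<open>q\<close> are both cokernels of \<open>i\<close>, identities together with the comparison
  \<open>u\<close> form an isomorphism of pairs.\<close>

lemma admissible_monic_cokernel:
  assumes "admissible_monic E i" "is_cokernel C q i"
  shows "(i, q) \<in> E"
proof -
  obtain p where E: "(i, p) \<in> E" using assms unfolding admissible_monic_def by blast
  obtain A B D F where ty: "i \<in> Hom C A B" "p \<in> Hom C B D" and q: "q \<in> Hom C B F"
    using E_types[OF E] assms(2) that by (simp add: is_cokernel_def Hom_def)
  obtain u where u: "u \<in> Hom C D F" "is_iso C u" "u \<cdot> p = q"
    using cokernel_unique[OF ty q E_is_cokernel[OF E] assms(2)] .
  have Obj: "A \<in> Obj C" "B \<in> Obj C" using Hom_Obj[OF ty(1)] .
  have "Ident C B \<cdot> i = i \<cdot> Ident C A" "u \<cdot> p = q \<cdot> Ident C B"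
    using HomD[OF ty(1)] HomD[OF q] u(3) by simp_all
  then show ?thesis
    by (rule E_isoI[OF E ty ty(1) q Ident_in_Hom[OF Obj(1)] Ident_in_Hom[OF Obj(2)] u(1)
          is_iso_Ident[OF Obj(1)] is_iso_Ident[OF Obj(2)] u(2)])
qed

lemma admissible_epic_kernel:
  assumes "admissible_epic E p" "is_kernel C j p"
  shows "(j, p) \<in> E"
proof -
  obtain i where E: "(i, p) \<in> E" using assms unfolding admissible_epic_def by blast
  obtain A B D F where ty: "i \<in> Hom C A B" "p \<in> Hom C B D" and j: "j \<in> Hom C F B"
    using E_types[OF E] assms(2) that by (simp add: is_kernel_def Hom_def)
  obtain u where u: "u \<in> Hom C A F" "is_iso C u" "j \<cdot> u = i"
    using kernel_unique[OF ty(1) j ty(2) E_is_kernel[OF E] assms(2)] .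
  have Obj: "B \<in> Obj C" "D \<in> Obj C" using Hom_Obj[OF ty(2)] .
  have "Ident C B \<cdot> i = j \<cdot> u" "Ident C D \<cdot> p = p \<cdot> Ident C B"
    using HomD[OF ty(1)] HomD[OF ty(2)] u(3) by simp_all
  then show ?thesis
    by (rule E_isoI[OF E ty j ty(2) u(1) Ident_in_Hom[OF Obj(1)] Ident_in_Hom[OF Obj(2)]
          u(2) is_iso_Ident[OF Obj(1)] is_iso_Ident[OF Obj(2)]])
qed

text \<open>The axiom speaks of one push-out, whereas the given square may be another. With the
  comparison \<open>u\<close> and its inverse \<open>v\<close>, the identities and \<open>u\<close>
  form an isomorphism from \<open>(k, p)\<close> to \<open>(i', p \<cdot> v)\<close>.\<close>

lemma is_pushout_admissible_monic:
  assumes po: "is_pushout C i f f' i'" and i: "admissible_monic E i"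
  shows "admissible_monic E i'"
proof -
  have sq: "commutative_square C i f f' i'"
    using po unfolding is_pushout_def ..
  then have arr: "f \<in> Arr C" "Dom C f = Dom C i"
    by (simp_all add: commutative_square_def)
  obtain g k where po': "is_pushout C i f g k" and k: "admissible_monic E k"
    using pushout_admissible_monic[OF i arr] by blast
  have sq': "commutative_square C i f g k"
    using po' unfolding is_pushout_def ..
  obtain A B A' B' D where ty: "i \<in> Hom C A B" "f \<in> Hom C A A'" "f' \<in> Hom C B B'"
    "i' \<in> Hom C A' B'" "g \<in> Hom C B D" "k \<in> Hom C A' D"
    using sq sq' that by (simp add: commutative_square_def Hom_def)
  obtain u where u: "u \<in> Hom C D B'" "is_iso C u" "u \<cdot> k = i'"
    using pushout_unique[OF ty po po'] .
  obtain v where v: "v \<in> Hom C B' D" "v \<cdot> u = Ident C D"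
    using is_isoE[OF u(2,1)] by metis
  obtain p where E: "(k, p) \<in> E" using k unfolding admissible_monic_def by blast
  obtain F where p: "p \<in> Hom C D F" using E_types[OF E] HomD[OF ty(6)] that by simp
  note T = HomD[OF ty(4)] HomD[OF u(1)] HomD[OF v(1)] HomD[OF p]
  have Obj: "A' \<in> Obj C" "F \<in> Obj C" using Hom_Obj ty(6) p by blast+
  have "u \<cdot> k = i' \<cdot> Ident C A'" "Ident C F \<cdot> p = (p \<cdot> v) \<cdot> u"
    using T u(3) v(2) by (simp_all add: assoc)
  then have "(i', p \<cdot> v) \<in> E"
    by (rule E_isoI[OF E ty(6) p ty(4) Comp_in_Hom[OF v(1) p] Ident_in_Hom[OF Obj(1)] u(1)
          Ident_in_Hom[OF Obj(2)] is_iso_Ident[OF Obj(1)] u(2) is_iso_Ident[OF Obj(2)]])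
  then show ?thesis unfolding admissible_monic_def by blast
qed

lemma is_pullback_admissible_epic:
  assumes pb: "is_pullback C p' f' f p" and p: "admissible_epic E p"
  shows "admissible_epic E p'"
proof -
  have sq: "commutative_square C p' f' f p"
    using pb unfolding is_pullback_def ..
  then have arr: "f \<in> Arr C" "Cod C f = Cod C p"
    by (simp_all add: commutative_square_def)
  obtain g k where pb': "is_pullback C g k f p" and g: "admissible_epic E g"
    using pullback_admissible_epic[OF p arr] by blast
  have sq': "commutative_square C g k f p"
    using pb' unfolding is_pullback_def ..
  obtain A B A' B' D where ty: "p' \<in> Hom C A B" "f' \<in> Hom C A A'" "f \<in> Hom C B B'"
    "p \<in> Hom C A' B'" "g \<in> Hom C D B" "k \<in> Hom C D A'"
    using sq sq' that by (simp add: commutative_square_def Hom_def)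
  obtain u where u: "u \<in> Hom C A D" "is_iso C u" "g \<cdot> u = p'"
    using pullback_unique[OF ty pb pb'] .
  obtain v where v: "v \<in> Hom C D A" "v \<cdot> u = Ident C A" "u \<cdot> v = Ident C D"
    using is_isoE[OF u(2,1)] by metis
  \<comment> \<open>The isomorphism of pairs starts at \<open>(i, g)\<close> and ends at
    \<open>(v \<cdot> i, p')\<close>, so its middle arrow is the inverse of the comparison.\<close>
  have "is_iso C v" using is_isoI[OF v(1) u(1) v(3,2)] .
  obtain i where E: "(i, g) \<in> E" using g unfolding admissible_epic_def by blast
  obtain F where i: "i \<in> Hom C F D" using E_types[OF E] HomD[OF ty(5)] that by (simp add: Hom_def)
  note T = HomD[OF ty(1)] HomD[OF ty(5)] HomD[OF u(1)] HomD[OF v(1)] HomD[OF i]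
  have Obj: "F \<in> Obj C" "B \<in> Obj C" using Hom_Obj ty(5) i by blast+
  have "p' \<cdot> v = g" using assoc[of v u g] u(3) v(3) T by simp
  then have "v \<cdot> i = (v \<cdot> i) \<cdot> Ident C F" "Ident C B \<cdot> g = p' \<cdot> v"
    using T by simp_all
  then have "(v \<cdot> i, p') \<in> E"
    by (rule E_isoI[OF E i ty(5) Comp_in_Hom[OF i v(1)] ty(1) Ident_in_Hom[OF Obj(1)] v(1)
          Ident_in_Hom[OF Obj(2)] is_iso_Ident[OF Obj(1)] \<open>is_iso C v\<close> is_iso_Ident[OF Obj(2)]])
  then show ?thesis unfolding admissible_epic_def by blast
qed

text \<open>An identity is an admissible epic, and its partner \<open>z\<close> satisfies
  \<open>z = Ident C A \<cdot> z\<close>, which is zero.\<close>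

lemma admissible_monic_Zero:
  assumes "A \<in> Obj C"
  obtains Z where "Z \<in> Obj C" "admissible_monic E (Zero C Z A)"
proof -
  obtain z where E: "(z, Ident C A) \<in> E"
    using Ident_admissible_epic[OF assms] by (auto simp: admissible_epic_def)
  have z: "z \<in> Arr C" "Cod C z = A" "Ident C A \<cdot> z = Zero C (Dom C z) A"
    using E_is_kernel[OF E] assms by (auto simp: is_kernel_def)
  then have "z = Zero C (Dom C z) A" by simp
  then show thesis using that[of "Dom C z"] E z by (auto simp: admissible_monic_def)
qed

text \<open>\<open>[1; g] : A \<rightarrow> A \<oplus> B\<close> is admissible because it is, together with the injection of \<open>B\<close>, another
  coproduct of \<open>A\<close> and \<open>B\<close>, hence the push-out of some admissible \<open>0 \<rightarrow> B\<close> along a zero morphism.\<close>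

lemma admissible_monic_graph:
  assumes "is_biproduct C A B S j\<^sub>1 j\<^sub>2 q\<^sub>1 q\<^sub>2" and g: "g \<in> Hom C A B"
  shows "admissible_monic E (column C j\<^sub>1 j\<^sub>2 (Ident C A) g)"
proof -
  interpret biproduct C A B S j\<^sub>1 j\<^sub>2 q\<^sub>1 q\<^sub>2 by unfold_locales fact
  define e where "e = column C j\<^sub>1 j\<^sub>2 (Ident C A) g"
  note g' = HomD[OF g]
  have e: "e \<in> Hom C A S" using g' by (simp add: e_def Hom_def)
  obtain Z where Z: "Z \<in> Obj C" "admissible_monic E (Zero C Z B)"
    using admissible_monic_Zero[of B] by auto
  have ty: "Zero C Z B \<in> Hom C Z B" "Zero C Z A \<in> Hom C Z A" "j\<^sub>2 \<in> Hom C B S"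
    using Z by (auto simp: Hom_def)
  have "is_pushout C (Zero C Z B) (Zero C Z A) j\<^sub>2 e"
    unfolding is_pushout_iff[OF ty e]
  proof (intro conjI allI impI; (elim conjE)?)
    show "j\<^sub>2 \<cdot> Zero C Z B = e \<cdot> Zero C Z A" using e Z by (simp add: Hom_def)
    \<comment> \<open>Composites with zero arrows vanish, so every pair \<open>k\<close>,
      \<open>h\<close> is compatible and the push-out property is that of a coproduct.\<close>
    fix X k h assume kh: "k \<in> Hom C B X" "h \<in> Hom C A X"
    note kh' = HomD[OF kh(1)] HomD[OF kh(2)]
    \<comment> \<open>Since \<open>u \<cdot> e\<close> is the sum of
      \<open>u \<cdot> j\<^sub>1\<close> and \<open>k \<cdot> g\<close>, solving for the first
      component gives the difference that defines the witness below.\<close>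
    have ue: "u \<cdot> e = h \<longleftrightarrow> u \<cdot> j\<^sub>1 = h \<boxplus> Neg C (k \<cdot> g)"
      if "u \<in> Hom C S X" "u \<cdot> j\<^sub>2 = k" for u
    proof -
      note u = HomD[OF that(1)]
      have "u \<cdot> e = k \<cdot> g \<boxplus> u \<cdot> j\<^sub>1"
        using u that(2) g' kh' by (simp add: e_def comp_column Add_commute)
      moreover have "h = k \<cdot> g \<boxplus> (h \<boxplus> Neg C (k \<cdot> g))"
        using g' kh' by (simp add: Add_commute[of h] Add_assoc[symmetric])
      ultimately have "u \<cdot> e = h \<longleftrightarrow> k \<cdot> g \<boxplus> u \<cdot> j\<^sub>1 = k \<cdot> g \<boxplus> (h \<boxplus> Neg C (k \<cdot> g))"
        by simp
      then show ?thesis using u g' kh' by (simp add: Add_left_cancel)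
    qed
    let ?u = "row C q\<^sub>1 q\<^sub>2 (h \<boxplus> Neg C (k \<cdot> g)) k"
    show "\<exists>!u. u \<in> Hom C S X \<and> u \<cdot> j\<^sub>2 = k \<and> u \<cdot> e = h"
    proof (rule ex1I[of _ ?u])
      have "?u \<in> Hom C S X" "?u \<cdot> j\<^sub>2 = k" "?u \<cdot> j\<^sub>1 = h \<boxplus> Neg C (k \<cdot> g)"
        using kh' g' by (auto simp: Hom_def)
      then show "?u \<in> Hom C S X \<and> ?u \<cdot> j\<^sub>2 = k \<and> ?u \<cdot> e = h" using ue by simp
    next
      fix u assume u: "u \<in> Hom C S X \<and> u \<cdot> j\<^sub>2 = k \<and> u \<cdot> e = h"
      then have "u \<cdot> j\<^sub>1 = h \<boxplus> Neg C (k \<cdot> g)" using ue by blast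
      then show "u = ?u" using u kh' g' by (subst eq_iff_inj) (auto simp: Hom_def)
    qed
  qed
  then show ?thesis using is_pushout_admissible_monic Z(2) unfolding e_def by blast
qed

text \<open>The column factors as \<open>[1; g] : A \<rightarrow> A \<oplus> A'\<close> followed by \<open>i \<oplus> 1\<close>, and \<open>i \<oplus> 1\<close> is the push-out of
  \<open>i\<close> along the injection of \<open>A\<close>.\<close>

lemma admissible_monic_column:
  assumes S: "is_biproduct C B A' S j\<^sub>1 j\<^sub>2 q\<^sub>1 q\<^sub>2"
    and i: "i \<in> Hom C A B" "admissible_monic E i" and g: "g \<in> Hom C A A'"
  shows "admissible_monic E (column C j\<^sub>1 j\<^sub>2 i g)"
proof -
  interpret S: biproduct C B A' S j\<^sub>1 j\<^sub>2 q\<^sub>1 q\<^sub>2 by unfold_locales fact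
  obtain T a\<^sub>1 a\<^sub>2 b\<^sub>1 b\<^sub>2 where T: "is_biproduct C A A' T a\<^sub>1 a\<^sub>2 b\<^sub>1 b\<^sub>2"
    using biproducts_exist[of A A'] Hom_Obj[OF i(1)] by auto
  interpret T: biproduct C A A' T a\<^sub>1 a\<^sub>2 b\<^sub>1 b\<^sub>2 by unfold_locales fact
  note i' = HomD[OF i(1)] and g' = HomD[OF g]
  \<comment> \<open>This is \<open>i \<oplus> 1\<close>, described by its restrictions to the two
    summands of \<open>T\<close>.\<close>
  define w where "w = row C b\<^sub>1 b\<^sub>2 (j\<^sub>1 \<cdot> i) j\<^sub>2"
  define e where "e = column C a\<^sub>1 a\<^sub>2 (Ident C A) g"
  have w: "w \<in> Hom C T S" "w \<cdot> a\<^sub>1 = j\<^sub>1 \<cdot> i" "w \<cdot> a\<^sub>2 = j\<^sub>2"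
    using i' by (auto simp: w_def Hom_def)
  have ty: "a\<^sub>1 \<in> Hom C A T" "j\<^sub>1 \<in> Hom C B S" by (auto simp: Hom_def)
  have "is_pushout C i a\<^sub>1 j\<^sub>1 w"
    unfolding is_pushout_iff[OF i(1) ty w(1)]
  proof (intro conjI allI impI; (elim conjE)?)
    show "j\<^sub>1 \<cdot> i = w \<cdot> a\<^sub>1" using w by simp
    fix X k h assume kh: "k \<in> Hom C B X" "h \<in> Hom C T X" "k \<cdot> i = h \<cdot> a\<^sub>1"
    note kh' = HomD[OF kh(1)] HomD[OF kh(2)]
    let ?u = "row C q\<^sub>1 q\<^sub>2 k (h \<cdot> a\<^sub>2)"
    \<comment> \<open>On the first summand of \<open>T\<close> the two sides agree automatically, by
      \<open>k \<cdot> i = h \<cdot> a\<^sub>1\<close>; only the second summand leaves a condition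
      on \<open>u\<close>.\<close>
    have uw: "u \<cdot> w = h \<longleftrightarrow> u \<cdot> j\<^sub>2 = h \<cdot> a\<^sub>2" if "u \<in> Hom C S X" "u \<cdot> j\<^sub>1 = k" for u
    proof -
      note u = HomD[OF that(1)]
      have "(u \<cdot> w) \<cdot> a\<^sub>1 = h \<cdot> a\<^sub>1"
        using u i' that(2) w kh(3) HomD[OF w(1)] assoc[of i j\<^sub>1 u] by (simp add: assoc)
      moreover have "(u \<cdot> w) \<cdot> a\<^sub>2 = u \<cdot> j\<^sub>2"
        using u w HomD[OF w(1)] by (simp add: assoc)
      ultimately show ?thesis
        using u kh' HomD[OF w(1)] by (simp add: T.eq_iff_inj)
    qed
    show "\<exists>!u. u \<in> Hom C S X \<and> u \<cdot> j\<^sub>1 = k \<and> u \<cdot> w = h"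
    proof (rule ex1I[of _ ?u])
      have "?u \<in> Hom C S X" "?u \<cdot> j\<^sub>1 = k" "?u \<cdot> j\<^sub>2 = h \<cdot> a\<^sub>2"
        using kh' by (auto simp: Hom_def)
      then show "?u \<in> Hom C S X \<and> ?u \<cdot> j\<^sub>1 = k \<and> ?u \<cdot> w = h" using uw by simp
    next
      fix u assume u: "u \<in> Hom C S X \<and> u \<cdot> j\<^sub>1 = k \<and> u \<cdot> w = h"
      then have "u \<cdot> j\<^sub>2 = h \<cdot> a\<^sub>2" using uw by blast
      then show "u = ?u" using u kh' by (subst S.eq_iff_inj) (auto simp: Hom_def)
    qed
  qed
  then have "admissible_monic E w" using is_pushout_admissible_monic i(2) by blast
  moreover have "admissible_monic E e"
    unfolding e_def by (rule admissible_monic_graph[OF T g])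
  moreover have "Cod C e = Dom C w" using w g' by (simp add: e_def Hom_def)
  ultimately have "admissible_monic E (w \<cdot> e)" using Comp_admissible_monic by blast
  moreover have "w \<cdot> e = column C j\<^sub>1 j\<^sub>2 i g"
    using HomD[OF w(1)] w(2,3) i' g' by (simp add: e_def T.comp_column column_def[of C j\<^sub>1])
  ultimately show ?thesis by simp
qed

section \<open>The implications between the four assertions\<close>

lemma is_pushout_imp_short_exact:
  assumes S: "is_biproduct C B A' S j\<^sub>1 j\<^sub>2 q\<^sub>1 q\<^sub>2"
    and i: "i \<in> Hom C A B" "admissible_monic E i" and i': "i' \<in> Hom C A' B'"
    and f: "f \<in> Hom C A A'" and f': "f' \<in> Hom C B B'"
    and po: "is_pushout C i f f' i'"
  shows "(column C j\<^sub>1 j\<^sub>2 i (Neg C f), row C q\<^sub>1 q\<^sub>2 f' i') \<in> E"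
proof -
  interpret biproduct C B A' S j\<^sub>1 j\<^sub>2 q\<^sub>1 q\<^sub>2 by unfold_locales fact
  have "Neg C f \<in> Hom C A A'" using f by (auto simp: Hom_def)
  then have "admissible_monic E (column C j\<^sub>1 j\<^sub>2 i (Neg C f))"
    using admissible_monic_column[OF S i] by blast
  then show ?thesis
    using admissible_monic_cokernel po is_pushout_iff_is_cokernel[OF i(1) f f' i'] by blast
qed

text \<open>The pair of \<open>p\<close> and zero is compatible because \<open>p \<cdot> i\<close>
  vanishes, and it induces \<open>p'\<close>. If \<open>g\<close> annihilates \<open>i'\<close>,
  then \<open>g \<cdot> f'\<close> annihilates \<open>i\<close> and so factors through
  \<open>p\<close>; the same factor works for \<open>g\<close> and \<open>p'\<close>. Hence
  \<open>p'\<close> is a cokernel of the admissible monic \<open>i'\<close>.\<close>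

lemma is_pushout_imp_same_cokernel:
  assumes i: "i \<in> Hom C A B" "admissible_monic E i" and i': "i' \<in> Hom C A' B'"
    and f: "f \<in> Hom C A A'" and f': "f' \<in> Hom C B B'"
    and po: "is_pushout C i f f' i'"
  obtains X p p' where "p \<in> Hom C B X" "p' \<in> Hom C B' X" "p' \<cdot> f' = p" "(i, p) \<in> E" "(i', p') \<in> E"
proof -
  note P = po[unfolded is_pushout_iff[OF i(1) f f' i']]
  obtain p where E: "(i, p) \<in> E" using i(2) by (auto simp: admissible_monic_def)
  define X where "X = Cod C p"
  have p: "p \<in> Hom C B X" using E_types[OF E] i by (simp add: X_def Hom_def)
  note ck = E_is_cokernel[OF E]
  note K = ck[unfolded is_cokernel_iff[OF i(1) p]]
  have Obj: "A \<in> Obj C" "A' \<in> Obj C" "X \<in> Obj C" using Hom_Obj i i' p by blast+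
  note T = HomD[OF i(1)] HomD[OF f] HomD[OF f'] HomD[OF i'] HomD[OF p]
  have "Zero C A' X \<in> Hom C A' X" using Obj by (simp add: Hom_def)
  moreover have "p \<cdot> i = Zero C A' X \<cdot> f" using K T Obj by simp
  ultimately obtain p' where p': "p' \<in> Hom C B' X" "p' \<cdot> f' = p" "p' \<cdot> i' = Zero C A' X"
    using P p by metis
  note T = T HomD[OF p'(1)]
  have up: "(u \<cdot> p') \<cdot> f' = u \<cdot> p" if "u \<in> Hom C X Y" for u Y
    using HomD[OF that] T p'(2) by (simp add: assoc)
  have "is_cokernel C p' i'"
    unfolding is_cokernel_iff[OF i' p'(1)]
  proof (intro conjI allI impI; (elim conjE)?)
    show "p' \<cdot> i' = Zero C A' X" by fact
    fix Y g assume g: "g \<in> Hom C B' Y" "g \<cdot> i' = Zero C A' Y"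
    note g' = HomD[OF g(1)]
    have Y: "Y \<in> Obj C" using Hom_Obj g(1) by blast
    have "(g \<cdot> f') \<cdot> i = (g \<cdot> i') \<cdot> f" using g' T P by (simp add: assoc)
    also have "\<dots> = Zero C A Y" using g(2) T Y Obj by simp
    finally have "(g \<cdot> f') \<cdot> i = Zero C A Y" .
    moreover have gf: "g \<cdot> f' \<in> Hom C B Y" using g' T by (simp add: Hom_def)
    ultimately obtain u where u: "u \<in> Hom C X Y" "u \<cdot> p = g \<cdot> f'" using K by metis
    note u' = HomD[OF u(1)]
    \<comment> \<open>Arrows out of the push-out are compared on the legs \<open>i'\<close> and
      \<open>f'\<close>; on \<open>i'\<close> both sides are zero.\<close>
    have "(u \<cdot> p') \<cdot> i' = g \<cdot> i'" using u' T p'(3) g(2) Obj by (simp add: assoc)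
    moreover have "(u \<cdot> p') \<cdot> f' = g \<cdot> f'" using up[OF u(1)] u(2) by simp
    moreover have "(g \<cdot> f') \<cdot> i = (g \<cdot> i') \<cdot> f" by fact
    moreover have "g \<cdot> i' \<in> Hom C A' Y" "u \<cdot> p' \<in> Hom C B' Y"
      using g' u' T by (simp_all add: Hom_def)
    ultimately have "u \<cdot> p' = g" using P gf g(1) by metis
    then show "\<exists>!u. u \<in> Hom C X Y \<and> u \<cdot> p' = g"
      using u cokernel_epic[OF ck i(1) p] up by metis
  qed
  moreover have "admissible_monic E i'" using is_pushout_admissible_monic po i(2) .
  ultimately have "(i', p') \<in> E" using admissible_monic_cokernel by blast
  then show thesis using that p p' E by blast
qed

text \<open>The pull-back of \<open>p\<close> and \<open>p'\<close> projects onto \<open>B\<close> with kernel \<open>A'\<close> and section \<open>[f'; 1]\<close>; hence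
  it is \<open>B \<oplus> A'\<close>.\<close>

lemma same_cokernel_imp_short_exact:
  assumes S: "is_biproduct C B A' S j\<^sub>1 j\<^sub>2 q\<^sub>1 q\<^sub>2"
    and i: "i \<in> Hom C A B" and i': "i' \<in> Hom C A' B'"
    and f: "f \<in> Hom C A A'" and f': "f' \<in> Hom C B B'" and comm: "f' \<cdot> i = i' \<cdot> f"
    and p: "p \<in> Hom C B X" "p' \<in> Hom C B' X" "p' \<cdot> f' = p" "(i, p) \<in> E" "(i', p') \<in> E"
  shows "(column C j\<^sub>1 j\<^sub>2 i (Neg C f), row C q\<^sub>1 q\<^sub>2 f' i') \<in> E"
proof -
  interpret biproduct C B A' S j\<^sub>1 j\<^sub>2 q\<^sub>1 q\<^sub>2 by unfold_locales fact
  define r where "r = row C q\<^sub>1 q\<^sub>2 f' i'"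
  note ker = E_is_kernel[OF p(4)] and ker' = E_is_kernel[OF p(5)]
  note K = ker[unfolded is_kernel_iff[OF i p(1)]]
  note K' = ker'[unfolded is_kernel_iff[OF i' p(2)]]
  note T = HomD[OF i] HomD[OF f] HomD[OF f'] HomD[OF i'] HomD[OF p(1)] HomD[OF p(2)]
  have r: "r \<in> Hom C S B'" using T by (simp add: r_def Hom_def)
  note r' = HomD[OF r]
  have q: "q\<^sub>1 \<in> Hom C S B" by (simp add: Hom_def)
  have ru: "r \<cdot> u = f' \<cdot> (q\<^sub>1 \<cdot> u) \<boxplus> i' \<cdot> (q\<^sub>2 \<cdot> u)" if "u \<in> Hom C Y S" for u Y
    using HomD[OF that] T by (simp add: r_def row_comp)
  have pi: "p' \<cdot> (i' \<cdot> u) = Zero C Y X" if "u \<in> Hom C Y A'" for u Y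
    using HomD[OF that] T reassoc[of p' i' _ u] K' Hom_Obj[OF p(1)] by simp
  have pf: "p' \<cdot> (f' \<cdot> u) = p \<cdot> u" if "u \<in> Hom C Y B" for u Y
    using HomD[OF that] T reassoc[of p' f' _ u] p(3) by simp
  have "is_pullback C r q\<^sub>1 p' p"
    unfolding is_pullback_iff[OF r q p(2,1)]
  proof (intro conjI allI impI; (elim conjE)?)
    have "p' \<cdot> r = p' \<cdot> (f' \<cdot> q\<^sub>1) \<boxplus> p' \<cdot> (i' \<cdot> q\<^sub>2)"
      using T by (simp add: r_def row_def)
    also have "\<dots> = p \<cdot> q\<^sub>1"
      using pi[of q\<^sub>2 S] pf[of q\<^sub>1 S] T by (simp add: Hom_def)
    finally show "p' \<cdot> r = p \<cdot> q\<^sub>1" .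
    fix Y g h assume gh: "g \<in> Hom C Y B'" "h \<in> Hom C Y B" "p' \<cdot> g = p \<cdot> h"
    note gh' = HomD[OF gh(1)] HomD[OF gh(2)]
    \<comment> \<open>Both \<open>g\<close> and \<open>f' \<cdot> h\<close> become
      \<open>p \<cdot> h\<close> after \<open>p'\<close>, so their difference factors through the
      kernel \<open>i'\<close>; the factor \<open>v\<close> is the missing component in
      \<open>A'\<close>.\<close>
    define d where "d = g \<boxplus> Neg C (f' \<cdot> h)"
    have d: "d \<in> Hom C Y B'" using gh' T by (simp add: d_def Hom_def)
    have "p' \<cdot> d = p \<cdot> h \<boxplus> Neg C (p \<cdot> h)"
      using gh' T gh(3) pf[OF gh(2)] by (simp add: d_def)
    also have "\<dots> = Zero C Y X" using gh' T by simp
    finally obtain v where v: "v \<in> Hom C Y A'" "i' \<cdot> v = d" using K' d by metis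
    note v' = HomD[OF v(1)]
    have g: "f' \<cdot> h \<boxplus> i' \<cdot> v = g"
      unfolding v(2) d_def using gh' T by (simp add: Add_commute[of g] Add_assoc[symmetric])
    \<comment> \<open>With the first component fixed to \<open>h\<close>, subtracting
      \<open>f' \<cdot> h\<close> and using that \<open>i'\<close> is monic determines the second
      component, which gives existence and uniqueness together.\<close>
    have rug: "r \<cdot> u = g \<longleftrightarrow> q\<^sub>2 \<cdot> u = v" if u: "u \<in> Hom C Y S" "q\<^sub>1 \<cdot> u = h" for u
    proof -
      have q2: "q\<^sub>2 \<cdot> u \<in> Hom C Y A'" using u by (auto simp: Hom_def)
      have "r \<cdot> u = g \<longleftrightarrow> f' \<cdot> h \<boxplus> i' \<cdot> (q\<^sub>2 \<cdot> u) = f' \<cdot> h \<boxplus> i' \<cdot> v"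
        using ru[OF u(1)] u(2) g by simp
      also have "\<dots> \<longleftrightarrow> i' \<cdot> (q\<^sub>2 \<cdot> u) = i' \<cdot> v"
        using HomD[OF q2] gh' v' T by (intro Add_left_cancel) auto
      also have "\<dots> \<longleftrightarrow> q\<^sub>2 \<cdot> u = v"
        using kernel_monic[OF ker' i' p(2) q2 v(1)] by auto
      finally show ?thesis .
    qed
    let ?u = "column C j\<^sub>1 j\<^sub>2 h v"
    show "\<exists>!u. u \<in> Hom C Y S \<and> r \<cdot> u = g \<and> q\<^sub>1 \<cdot> u = h"
    proof (rule ex1I[of _ ?u])
      have "?u \<in> Hom C Y S" "q\<^sub>1 \<cdot> ?u = h" "q\<^sub>2 \<cdot> ?u = v"
        using gh' v' by (simp_all add: Hom_def)
      then show "?u \<in> Hom C Y S \<and> r \<cdot> ?u = g \<and> q\<^sub>1 \<cdot> ?u = h" using rug by blast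
    next
      fix u assume u: "u \<in> Hom C Y S \<and> r \<cdot> u = g \<and> q\<^sub>1 \<cdot> u = h"
      then have "q\<^sub>2 \<cdot> u = v" using rug by blast
      then show "u = ?u" using u gh' v' by (subst eq_iff_proj) (auto simp: Hom_def)
    qed
  qed
  moreover have "admissible_epic E p" using p(4) by (auto simp: admissible_epic_def)
  ultimately have epic: "admissible_epic E r" using is_pullback_admissible_epic by blast
  \<comment> \<open>For a compatible pair, \<open>p \<cdot> g = p' \<cdot> (f' \<cdot> g) = p'
    \<cdot> (i' \<cdot> h)\<close> is zero, so \<open>g\<close> factors through the kernel
    \<open>i\<close>; that the factor also yields \<open>h\<close> is tested after the monic
    \<open>i'\<close>.\<close>
  have "is_pullback C i f f' i'"
    unfolding is_pullback_iff[OF i f f' i']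
  proof (intro conjI allI impI; (elim conjE)?)
    show "f' \<cdot> i = i' \<cdot> f" by fact
    fix Y g h assume gh: "g \<in> Hom C Y B" "h \<in> Hom C Y A'" "f' \<cdot> g = i' \<cdot> h"
    have "p \<cdot> g = Zero C Y X" using pf[OF gh(1)] pi[OF gh(2)] gh(3) by simp
    then obtain u where u: "u \<in> Hom C Y A" "i \<cdot> u = g" using K gh(1) by metis
    have "i' \<cdot> (f \<cdot> u) = (f' \<cdot> i) \<cdot> u"
      using HomD[OF u(1)] T comm by (simp add: assoc)
    also have "\<dots> = i' \<cdot> h"
      using HomD[OF u(1)] T u(2) gh(3) by (simp add: assoc)
    finally have "f \<cdot> u = h"
      using kernel_monic[OF ker' i' p(2) Comp_in_Hom[OF u(1) f] gh(2)] by simp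
    then show "\<exists>!u. u \<in> Hom C Y A \<and> i \<cdot> u = g \<and> f \<cdot> u = h"
      using u kernel_monic[OF ker i p(1)] by metis
  qed
  then show ?thesis
    using admissible_epic_kernel epic is_pullback_iff_is_kernel[OF i f f' i'] unfolding r_def by blast
qed

end

theorem proposition2p12:
  fixes C :: "('o, 'm) acat" (structure) and E :: "('m \<times> 'm) set"
    and A A' B B' S :: 'o and i f f' i' j\<^sub>1 j\<^sub>2 q\<^sub>1 q\<^sub>2 :: 'm
  assumes exact: "exact_category C E"
    and i: "i \<in> Hom C A B" "admissible_monic E i"
    and i': "i' \<in> Hom C A' B'" "admissible_monic E i'"
    and f: "f \<in> Hom C A A'"
    and f': "f' \<in> Hom C B B'"
    and comm: "f' \<cdot> i = i' \<cdot> f"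
    and S: "is_biproduct C B A' S j\<^sub>1 j\<^sub>2 q\<^sub>1 q\<^sub>2"
  shows "(is_pushout C i f f' i'
            \<longleftrightarrow> (column C j\<^sub>1 j\<^sub>2 i (Neg C f), row C q\<^sub>1 q\<^sub>2 f' i') \<in> E) \<and>
         (is_pushout C i f f' i' \<longleftrightarrow> is_bicartesian C i f f' i') \<and>
         (is_pushout C i f f' i'
            \<longleftrightarrow> (\<exists>X p p'. p \<in> Hom C B X \<and> p' \<in> Hom C B' X \<and>
                   p' \<cdot> f' = p \<and> (i, p) \<in> E \<and> (i', p') \<in> E))"
proof -
  interpret exact_category C E by (rule exact)
  interpret biproduct C B A' S j\<^sub>1 j\<^sub>2 q\<^sub>1 q\<^sub>2 by unfold_locales (rule S)
  let ?ses = "(column C j\<^sub>1 j\<^sub>2 i (Neg C f), row C q\<^sub>1 q\<^sub>2 f' i') \<in> E"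
  let ?diagram = "\<exists>X p p'. p \<in> Hom C B X \<and> p' \<in> Hom C B' X \<and>
    p' \<cdot> f' = p \<and> (i, p) \<in> E \<and> (i', p') \<in> E"
  \<comment> \<open>Assertions (i), (ii), (iii) form a cycle, and (iv) is attached to it as a detour
    from (i) to (ii).\<close>
  have 1: "is_pushout C i f f' i' \<Longrightarrow> ?ses"
    using is_pushout_imp_short_exact[OF S i i'(1) f f'] .
  have 2: "?ses \<Longrightarrow> is_bicartesian C i f f' i'"
    using E_is_cokernel E_is_kernel is_pushout_iff_is_cokernel[OF i(1) f f' i'(1)]
      is_pullback_iff_is_kernel[OF i(1) f f' i'(1)]
    by (simp add: is_bicartesian_def)
  have 3: "is_bicartesian C i f f' i' \<Longrightarrow> is_pushout C i f f' i'"
    by (simp add: is_bicartesian_def)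
  have 4: "is_pushout C i f f' i' \<Longrightarrow> ?diagram"
    using is_pushout_imp_same_cokernel[OF i i'(1) f f'] by metis
  have 5: "?diagram \<Longrightarrow> ?ses"
    using same_cokernel_imp_short_exact[OF S i(1) i'(1) f f' comm] by blast
  show ?thesis using 1 2 3 4 5 by blast
qed

end
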